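(* For every integer $m \geq 3$ there is a primitive association scheme $\mathfrak{X}$ of degree $n = m^8$ and rank $28$ such that $\operatorname{Aut}(\mathfrak{X})$ is imprimitive (as a permutation group on the $n$ vertices) and $$|\operatorname{Aut}(\mathfrak{X})| = 8\,(m!)^8 \geq \exp(n^{1/8}).$$ Also $\mu(\operatorname{Aut}(\mathfrak{X})) = 2m^7 = 2n^{7/8}$ and $\theta(\operatorname{Aut}(\mathfrak{X})) = m = n^{1/8}$.
   Context: A configuration $\mathfrak{X}$ on a finite set $V$ is a partition of $V^2$ into nonempty relations $R_1,\dots,R_r$ such that (1) some subset of $\mathfrak{X}$ partitions the diagonal $\{(v,v): v\in V\}$, and (2) if $R\in\mathfrak{X}$ then $R^*=\{(x,y):(y,x)\in R\}\in\mathfrak{X}$. It is coherent if there are constants $p^i_{jk}$ such that for all $i,j,k$ and all $(u,v)\in R_i$, $\#\{w\in V:(u,w)\in R_j,(w,v)\in R_k\}=p^i_{jk}$. The degree is $|V|$ and the rank is the number $r$ of relations. $\mathfrak{X}$ is homogeneous if the diagonal is itself one of the relations, and symmetric if $R^*=R$ for every $R\in\mathfrak{X}$. An association scheme is a homogeneous symmetric coherent configuration. A homogeneous coherent configuration is primitive if for every relation $R\in\mathfrak{X}$ other than the diagonal, the directed graph $(V,R)$ is connected. $\operatorname{Aut}(\mathfrak{X})\leq\operatorname{Sym}(V)$ is the group of permutations of $V$ preserving each relation of $\mathfrak{X}$ individually. For a permutation group $G$, the minimal degree $\mu(G)$ is the minimal number of points moved by a nontrivial element of $G$, and the thickness $\theta(G)$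 is the largest $t$ such that $G$ has a section (a quotient of a subgroup) isomorphic to the alternating group $\operatorname{Alt}(t)$. *)

theory Defs
  imports Complex_Main "HOL-Library.Disjoint_Sets" "HOL-Algebra.Sym_Groups"
begin

text \<open>A configuration is given by its vertex set \<open>V\<close> and the set \<open>X\<close> of its relations;
  the degree is \<open>card V\<close> and the rank is \<open>card X\<close>.\<close>

definition configuration :: "'a set \<Rightarrow> 'a rel set \<Rightarrow> bool" where
  "configuration V X \<longleftrightarrow>
     finite V \<and> partition_on (V \<times> V) X \<and>
     (\<exists>D\<subseteq>X. partition_on (Id_on V) D) \<and>
     (\<forall>R\<in>X. R\<inverse> \<in> X)"

definition coherent :: "'a set \<Rightarrow> 'a rel set \<Rightarrow> bool" where
  "coherent V X \<longleftrightarrow>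
     (\<exists>p :: 'a rel \<Rightarrow> 'a rel \<Rightarrow> 'a rel \<Rightarrow> nat.
        \<forall>Ri\<in>X. \<forall>Rj\<in>X. \<forall>Rk\<in>X. \<forall>(u, v)\<in>Ri.
          card {w \<in> V. (u, w) \<in> Rj \<and> (w, v) \<in> Rk} = p Ri Rj Rk)"

definition homogeneous :: "'a set \<Rightarrow> 'a rel set \<Rightarrow> bool" where
  "homogeneous V X \<longleftrightarrow> Id_on V \<in> X"

definition symmetric :: "'a rel set \<Rightarrow> bool" where
  "symmetric X \<longleftrightarrow> (\<forall>R\<in>X. R\<inverse> = R)"

definition association_scheme :: "'a set \<Rightarrow> 'a rel set \<Rightarrow> bool" where
  "association_scheme V X \<longleftrightarrow>
     configuration V X \<and> coherent V X \<and> homogeneous V X \<and> symmetric X"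

text \<open>Connectedness of the digraph \<open>(V, R)\<close> is strong connectedness; for the relations of a
  symmetric configuration this is the same as weak connectedness.\<close>

definition primitive_configuration :: "'a set \<Rightarrow> 'a rel set \<Rightarrow> bool" where
  "primitive_configuration V X \<longleftrightarrow>
     configuration V X \<and> coherent V X \<and> homogeneous V X \<and>
     (\<forall>R\<in>X. R \<noteq> Id_on V \<longrightarrow> (\<forall>u\<in>V. \<forall>v\<in>V. (u, v) \<in> R\<^sup>*))"

text \<open>As for \<open>sym_group\<close> and \<open>alt_group\<close>, elements of a permutation group on \<open>V\<close> are functions
  on the whole type which are the identity outside \<open>V\<close>.\<close>

definition Aut :: "'a set \<Rightarrow> 'a rel set \<Rightarrow> ('a \<Rightarrow> 'a) monoid" where
  "Aut V X =
     \<lparr>carrier = {g. g permutes V \<and> (\<forall>R\<in>X. map_prod g g ` R = R)}, mult = (\<circ>), one = id\<rparr>"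

definition transitive_on :: "'a set \<Rightarrow> ('a \<Rightarrow> 'a) monoid \<Rightarrow> bool" where
  "transitive_on V G \<longleftrightarrow> (\<forall>u\<in>V. \<forall>v\<in>V. \<exists>g\<in>carrier G. g u = v)"

text \<open>A permutation group is imprimitive if it is transitive and preserves a partition of \<open>V\<close>
  that is neither the partition into singletons nor the partition with one part.\<close>

definition imprimitive_on :: "'a set \<Rightarrow> ('a \<Rightarrow> 'a) monoid \<Rightarrow> bool" where
  "imprimitive_on V G \<longleftrightarrow>
     transitive_on V G \<and>
     (\<exists>P. partition_on V P \<and> P \<noteq> {V} \<and> P \<noteq> (\<lambda>v. {v}) ` V \<and>
          (\<forall>g\<in>carrier G. \<forall>B\<in>P. g ` B \<in> P))"

text \<open>Meaningful for nontrivial \<open>G\<close> only.\<close>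

definition minimal_degree :: "'a set \<Rightarrow> ('a \<Rightarrow> 'a) monoid \<Rightarrow> nat" where
  "minimal_degree V G =
     (LEAST d. \<exists>g\<in>carrier G. g \<noteq> \<one>\<^bsub>G\<^esub> \<and> card {v \<in> V. g v \<noteq> v} = d)"

definition has_section :: "('a, 'b) monoid_scheme \<Rightarrow> ('c, 'd) monoid_scheme \<Rightarrow> bool" where
  "has_section G S \<longleftrightarrow>
     (\<exists>H N. subgroup H G \<and> N \<lhd> (G\<lparr>carrier := H\<rparr>) \<and> (G\<lparr>carrier := H\<rparr>) Mod N \<cong> S)"

text \<open>For finite \<open>G\<close> the orders of the alternating sections are bounded, so the maximum exists.\<close>

definition thickness :: "('a, 'b) monoid_scheme \<Rightarrow> nat" where
  "thickness G = (GREATEST t. has_section G (alt_group t))"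

lemma group_Aut: "group (Aut V X)"
proof (rule groupI)
  fix g assume g: "g \<in> carrier (Aut V X)"
  then have p: "g permutes V" and R: "\<And>R. R \<in> X \<Longrightarrow> map_prod g g ` R = R"
    by (auto simp: Aut_def)
  have "map_prod (inv' g) (inv' g) ` R = R" if "R \<in> X" for R
  proof -
    have "map_prod (inv' g) (inv' g) ` R = map_prod (inv' g) (inv' g) ` map_prod g g ` R"
      using R[OF that] by simp
    also have "\<dots> = R"
      by (simp add: image_comp map_prod.comp permutes_inv_o[OF p] map_prod.id)
    finally show ?thesis .
  qed
  then have "inv' g \<in> carrier (Aut V X)"
    using permutes_inv[OF p] by (simp add: Aut_def)
  moreover have "inv' g \<circ> g = id" using permutes_inv_o[OF p] by simp
  ultimately show "\<exists>h\<in>carrier (Aut V X). h \<otimes>\<^bsub>Aut V X\<^esub> g = \<one>\<^bsub>Aut V X\<^esub>"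
    by (auto simp: Aut_def)
next
  fix g h assume "g \<in> carrier (Aut V X)" "h \<in> carrier (Aut V X)"
  then have "map_prod (g \<circ> h) (g \<circ> h) ` R = R" if "R \<in> X" for R
    using that by (simp only: Aut_def map_prod.comp[symmetric] image_comp[symmetric]) simp
  with \<open>g \<in> _\<close> \<open>h \<in> _\<close> show "g \<otimes>\<^bsub>Aut V X\<^esub> h \<in> carrier (Aut V X)"
    by (simp add: Aut_def permutes_compose)
qed (simp_all add: Aut_def comp_assoc permutes_id map_prod.id)

end

theory Submission
  imports Defs "HOL-Library.List_Lexorder"
begin

text \<open>
  The points are the words of length \<open>8\<close> over an alphabet of \<open>m\<close> letters, and two words \<open>u\<close>, \<open>v\<close>
  are compared through the set \<open>diff u v\<close> of positions in which they differ. A typing \<open>ty\<close> of the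
  subsets of \<open>{0..7}\<close> that refines their cardinality yields a family of relations, the pairs
  \<open>(u, v)\<close> with a given type of \<open>diff u v\<close>. The family is coarser than the eighth tensor power of
  the trivial scheme on \<open>m\<close> points and finer than the Hamming scheme; if it is coherent, it is
  called a Hamming sandwich.

  Coherence follows from a condition on the typing in which \<open>m\<close> does not occur: the type of a set
  \<open>A\<close> determines the multiset of the types of the sets \<open>A - {x}\<close> and that of the sets
  \<open>insert x A\<close>, i.e. that the types form an equitable partition of the Boolean lattice. Then the
  functions of the type are closed under summation over all subsets and over all supersets. The
  intersection numbers are values of a convolution on words, and Moebius inversion reduces it to
  these two summations: words that differ from \<open>u\<close> inside \<open>B\<close> and from \<open>v\<close> inside \<open>C\<close> exist
  only if \<open>diff u v \<subseteq> B \<union> C\<close>, and then there are \<open>m ^ card (B \<inter> C)\<close> of them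
  (\<open>convolution_class_fun\<close>). If moreover all singletons have one type and \<open>m \<ge> 3\<close>, every relation
  connects words that differ in one position in two steps, so the scheme is primitive.

  Automorphisms preserve the Hamming distance, hence they permute the coordinates by some \<open>\<pi>\<close> and
  the letters at each coordinate separately (\<open>isometry_direction\<close>, \<open>wreath_exhaust\<close>), where \<open>\<pi>\<close>
  lies in the stabiliser \<open>K\<close> of the typing. So the group is \<open>Sym(m)\<^sup>8\<close> extended by \<open>K\<close>. A
  \<open>K\<close>-invariant proper nonempty set of coordinates gives a system of blocks, so the group is
  imprimitive as soon as \<open>K\<close> is intransitive, which must happen although the scheme does not
  distinguish single coordinates. The typing \<open>octagon_type\<close> achieves this: it has \<open>28\<close> types, it is equitable, all
  singletons have one type, and its stabiliser has order \<open>8\<close> and fixes the set of even vertices of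
  the octagon.

  A section \<open>Alt(t)\<close> of the group comes from a homomorphism of a subgroup \<open>H\<close> onto \<open>Alt(t)\<close>. As
  \<open>K\<close> has exponent \<open>4\<close> and a 3-cycle is its own fourth power, \<open>H \<inter> Sym(m)\<^sup>8\<close> is still mapped onto
  \<open>Alt(t)\<close>. For \<open>t \<ge> 5\<close> two nontrivial normal subgroups of \<open>Alt(t)\<close> never centralise each other,
  whence the homomorphism depends on a single coordinate and \<open>t! / 2 \<le> m!\<close>. For \<open>t = 4\<close> and
  \<open>m = 3\<close>, squares commute in \<open>Sym(3)\<^sup>8\<close> but not in \<open>Alt(4)\<close>.
\<close>

section \<open>Functions of the type of a finite set\<close>

definition class_fun :: "nat \<Rightarrow> (nat set \<Rightarrow> 't) \<Rightarrow> (nat set \<Rightarrow> real) \<Rightarrow> bool" where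
  "class_fun d ty f \<longleftrightarrow> (\<forall>A B. A \<subseteq> {..<d} \<longrightarrow> B \<subseteq> {..<d} \<longrightarrow> ty A = ty B \<longrightarrow> f A = f B)"

lemma class_funD:
  "class_fun d ty f \<Longrightarrow> A \<subseteq> {..<d} \<Longrightarrow> B \<subseteq> {..<d} \<Longrightarrow> ty A = ty B \<Longrightarrow> f A = f B"
  unfolding class_fun_def by blast

lemma class_fun_cong:
  assumes "class_fun d ty f" "\<And>A. A \<subseteq> {..<d} \<Longrightarrow> f A = g A"
  shows "class_fun d ty g"
  using assms unfolding class_fun_def by metis

lemma class_fun_type: "class_fun d ty (\<lambda>A. h (ty A))"
  by (simp add: class_fun_def)

lemma class_fun_add: "class_fun d ty f \<Longrightarrow> class_fun d ty g \<Longrightarrow> class_fun d ty (\<lambda>A. f A + g A)"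
  and class_fun_diff: "class_fun d ty f \<Longrightarrow> class_fun d ty g \<Longrightarrow> class_fun d ty (\<lambda>A. f A - g A)"
  and class_fun_mult: "class_fun d ty f \<Longrightarrow> class_fun d ty g \<Longrightarrow> class_fun d ty (\<lambda>A. f A * g A)"
  unfolding class_fun_def by metis+

lemma class_fun_sum:
  "(\<And>k. k \<in> S \<Longrightarrow> class_fun d ty (f k)) \<Longrightarrow> class_fun d ty (\<lambda>A. \<Sum>k\<in>S. f k A)"
  unfolding class_fun_def by (metis (no_types, lifting) sum.cong)

text \<open>One half of equitability: only the upper neighbours in the Boolean lattice are
  controlled. The other half is this one for the typing of the complements.\<close>

locale up_regular =
  fixes d :: nat and ty :: "nat set \<Rightarrow> 't"
  assumes ty_up: "\<lbrakk>A \<subseteq> {..<d}; B \<subseteq> {..<d}; ty A = ty B\<rbrakk> \<Longrightarrow>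
    image_mset (\<lambda>x. ty (insert x A)) (mset_set ({..<d} - A)) =
    image_mset (\<lambda>x. ty (insert x B)) (mset_set ({..<d} - B))"
begin

text \<open>The sum is the integral of a function of the type against the multiset of the types of
  the upper neighbours of \<open>A\<close>, which depends on the type of \<open>A\<close> only.\<close>

lemma class_fun_step:
  assumes f: "class_fun d ty f"
  shows "class_fun d ty (\<lambda>A. \<Sum>x\<in>{..<d}-A. f (insert x A))"
  unfolding class_fun_def
proof (intro allI impI)
  fix A B assume A: "A \<subseteq> {..<d}" and B: "B \<subseteq> {..<d}" and AB: "ty A = ty B"
  define f' where "f' t = f (SOME A. A \<subseteq> {..<d} \<and> ty A = t)" for t
  have f': "f A = f' (ty A)" if "A \<subseteq> {..<d}" for A
    using someI[of "\<lambda>B. B \<subseteq> {..<d} \<and> ty B = ty A", OF conjI[OF that refl]] that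
    unfolding f'_def by (metis (no_types, lifting) class_funD[OF f])
  have *: "(\<Sum>x\<in>{..<d}-A. f (insert x A)) =
      sum_mset (image_mset f' (image_mset (\<lambda>x. ty (insert x A)) (mset_set ({..<d} - A))))"
    if "A \<subseteq> {..<d}" for A
  proof -
    have "(\<Sum>x\<in>{..<d}-A. f (insert x A)) = (\<Sum>x\<in>{..<d}-A. f' (ty (insert x A)))"
      using that by (intro sum.cong refl f') auto
    then show ?thesis by (simp add: sum_unfold_sum_mset multiset.map_comp comp_def)
  qed
  show "(\<Sum>x\<in>{..<d}-A. f (insert x A)) = (\<Sum>x\<in>{..<d}-B. f (insert x B))"
    using *[OF A] *[OF B] ty_up[OF A B AB] by simp
qed

text \<open>Summing over the upper neighbours \<open>insert x A\<close> the sums over sets \<open>k\<close> steps above them counts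
  every set \<open>Suc k\<close> steps above \<open>A\<close> exactly \<open>Suc k\<close> times, once for each of its additional points.\<close>

lemma class_fun_layer:
  assumes F: "class_fun d ty F"
  shows "class_fun d ty (\<lambda>A. \<Sum>B | A \<subseteq> B \<and> B \<subseteq> {..<d} \<and> card B = card A + k. F B)"
proof (induction k)
  case 0
  have "{B. A \<subseteq> B \<and> B \<subseteq> {..<d} \<and> card B = card A + 0} = {A}" if "A \<subseteq> {..<d}" for A
  proof -
    have "B = A" if "A \<subseteq> B" "B \<subseteq> {..<d}" "card B = card A" for B
      using card_subset_eq[of B A] that finite_subset[of B "{..<d}"] by simp
    then show ?thesis using that by auto
  qed
  then show ?case by (intro class_fun_cong[OF F]) simp
next
  case (Suc k)
  define S where "S k A = (\<Sum>B | A \<subseteq> B \<and> B \<subseteq> {..<d} \<and> card B = card A + k. F B)" for k A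
  have "real (Suc k) * S (Suc k) A = (\<Sum>x\<in>{..<d}-A. S k (insert x A))" if A: "A \<subseteq> {..<d}" for A
  proof -
    let ?L = "{B. A \<subseteq> B \<and> B \<subseteq> {..<d} \<and> card B = card A + Suc k}"
    have finA: "finite A" using A finite_subset by blast
    have finL: "finite ?L" by (rule finite_subset[of _ "Pow {..<d}"]) auto
    have "(\<Sum>x\<in>{..<d}-A. S k (insert x A)) = (\<Sum>x\<in>{..<d}-A. \<Sum>B | B \<in> ?L \<and> x \<in> B. F B)"
      unfolding S_def using finA A by (intro sum.cong refl) auto
    also have "\<dots> = (\<Sum>B\<in>?L. \<Sum>x | x \<in> {..<d}-A \<and> x \<in> B. F B)"
      by (rule sum.swap_restrict) (use finL in auto)
    also have "\<dots> = (\<Sum>B\<in>?L. real (Suc k) * F B)"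
    proof (rule sum.cong[OF refl])
      fix B assume B: "B \<in> ?L"
      then have "{x. x \<in> {..<d}-A \<and> x \<in> B} = B - A" by auto
      moreover have "card (B - A) = Suc k" using B finA by (simp add: card_Diff_subset)
      ultimately show "(\<Sum>x | x \<in> {..<d}-A \<and> x \<in> B. F B) = real (Suc k) * F B" by simp
    qed
    also have "\<dots> = real (Suc k) * S (Suc k) A" by (simp add: S_def sum_distrib_left)
    finally show ?thesis by simp
  qed
  then have "(\<Sum>x\<in>{..<d}-A. S k (insert x A)) / real (Suc k) = S (Suc k) A" if "A \<subseteq> {..<d}" for A
    using that by (metis nonzero_mult_div_cancel_left of_nat_Suc of_nat_neq_0)
  moreover have "class_fun d ty (\<lambda>A. (\<Sum>x\<in>{..<d}-A. S k (insert x A)) / real (Suc k))"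
    using class_fun_step[OF Suc[folded S_def]] unfolding class_fun_def by metis
  ultimately show ?case unfolding S_def[symmetric] by (rule class_fun_cong[rotated])
qed

lemma class_fun_superset_sum:
  assumes F: "class_fun d ty F"
  shows "class_fun d ty (\<lambda>A. \<Sum>B | A \<subseteq> B \<and> B \<subseteq> {..<d}. F B)"
proof (rule class_fun_cong)
  show "class_fun d ty (\<lambda>A. \<Sum>k\<le>d. \<Sum>B | A \<subseteq> B \<and> B \<subseteq> {..<d} \<and> card B = card A + k. F B)"
    by (intro class_fun_sum class_fun_layer F)
next
  fix A assume A: "A \<subseteq> {..<d}"
  let ?S = "{B. A \<subseteq> B \<and> B \<subseteq> {..<d}}"
  have fin: "finite ?S" by (rule finite_subset[of _ "Pow {..<d}"]) auto
  have le: "card A \<le> card B" if "B \<in> ?S" for B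
    using that by (auto intro: card_mono dest: finite_subset)
  have "{B. A \<subseteq> B \<and> B \<subseteq> {..<d} \<and> card B = card A + k} = {B \<in> ?S. card B - card A = k}" for k
    using le by force
  moreover have "(\<Sum>k\<le>d. \<Sum>B | B \<in> ?S \<and> card B - card A = k. F B) = (\<Sum>B\<in>?S. F B)"
  proof (rule sum.group[OF fin])
    show "(\<lambda>B. card B - card A) ` ?S \<subseteq> {..d}"
      using card_mono[of "{..<d}"] by (auto intro: diff_le_self[THEN le_trans])
  qed simp
  ultimately show "(\<Sum>k\<le>d. \<Sum>B | A \<subseteq> B \<and> B \<subseteq> {..<d} \<and> card B = card A + k. F B) = (\<Sum>B | A \<subseteq> B \<and> B \<subseteq> {..<d}. F B)"
    by simp
qed

end

text \<open>The type classes form an equitable partition of the Boolean lattice of the subsets of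
  \<open>{..<d}\<close>, graded by cardinality.\<close>

locale equitable_typing = up_regular d ty for d :: nat and ty :: "nat set \<Rightarrow> 't" +
  assumes ty_card: "\<lbrakk>A \<subseteq> {..<d}; B \<subseteq> {..<d}; ty A = ty B\<rbrakk> \<Longrightarrow> card A = card B"
    and ty_down: "\<lbrakk>A \<subseteq> {..<d}; B \<subseteq> {..<d}; ty A = ty B\<rbrakk> \<Longrightarrow>
    image_mset (\<lambda>x. ty (A - {x})) (mset_set A) = image_mset (\<lambda>x. ty (B - {x})) (mset_set B)"
begin

abbreviation "cls \<equiv> class_fun d ty"

lemma cls_card: "cls (\<lambda>A. h (card A))"
  unfolding class_fun_def by (metis ty_card)

lemma cls_restrict_card: "cls f \<Longrightarrow> cls (\<lambda>A. if P (card A) then f A else 0)"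
  unfolding class_fun_def by (metis ty_card)

text \<open>Complementation exchanges subsets and supersets.\<close>

lemma cls_subset_sum:
  assumes F: "cls F"
  shows "cls (\<lambda>A. \<Sum>B | B \<subseteq> A. F B)"
proof -
  interpret dual: up_regular d "\<lambda>A. ty ({..<d} - A)"
  proof
    fix A B assume *: "A \<subseteq> {..<d}" "B \<subseteq> {..<d}" "ty ({..<d} - A) = ty ({..<d} - B)"
    have "{..<d} - insert x A = ({..<d} - A) - {x}" for x A by auto
    then show "image_mset (\<lambda>x. ty ({..<d} - insert x A)) (mset_set ({..<d} - A)) =
       image_mset (\<lambda>x. ty ({..<d} - insert x B)) (mset_set ({..<d} - B))"
      using ty_down[OF _ _ *(3)] by simp
  qed
  have "class_fun d (\<lambda>A. ty ({..<d} - A)) (\<lambda>A. F ({..<d} - A))"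
    using F unfolding class_fun_def by (metis Diff_subset)
  from dual.class_fun_superset_sum[OF this]
  have *: "class_fun d (\<lambda>A. ty ({..<d} - A)) (\<lambda>A. \<Sum>B | A \<subseteq> B \<and> B \<subseteq> {..<d}. F ({..<d} - B))" .
  have eq: "(\<Sum>B | {..<d} - A \<subseteq> B \<and> B \<subseteq> {..<d}. F ({..<d} - B)) = (\<Sum>B | B \<subseteq> A. F B)"
    if "A \<subseteq> {..<d}" for A
    by (rule sum.reindex_bij_witness[of _ "\<lambda>B. {..<d} - B" "\<lambda>B. {..<d} - B"]) (use that in auto)
  show ?thesis unfolding class_fun_def
  proof (intro allI impI)
    fix A B assume AB: "A \<subseteq> {..<d}" "B \<subseteq> {..<d}" "ty A = ty B"
    have "{..<d} - ({..<d} - A) = A" "{..<d} - ({..<d} - B) = B" using AB by auto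
    then show "(\<Sum>C | C \<subseteq> A. F C) = (\<Sum>C | C \<subseteq> B. F C)"
      using class_funD[OF *, of "{..<d} - A" "{..<d} - B"] AB(3)
      by (simp add: eq[OF AB(1)] eq[OF AB(2)])
  qed
qed

text \<open>Moebius inversion inside the class functions, by triangularity: the top layer of \<open>f\<close> is
  subtracted together with its superset sums, which leaves a class function with fewer layers.\<close>

lemma cls_superset_inversion:
  assumes "cls f"
  shows "\<exists>F. cls F \<and> (\<forall>A\<subseteq>{..<d}. f A = (\<Sum>B | A \<subseteq> B \<and> B \<subseteq> {..<d}. F B))"
proof -
  have "\<exists>F. cls F \<and> (\<forall>A\<subseteq>{..<d}. f A = (\<Sum>B | A \<subseteq> B \<and> B \<subseteq> {..<d}. F B))"
    if "cls f" "\<And>A. A \<subseteq> {..<d} \<Longrightarrow> k \<le> card A \<Longrightarrow> f A = 0" for f k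
    using that
  proof (induction k arbitrary: f)
    case 0
    then show ?case by (intro exI[of _ "\<lambda>_. 0"]) (auto simp: class_fun_def)
  next
    case (Suc k)
    define f0 where "f0 A = (if card A = k then f A else 0)" for A
    have f0: "cls f0" unfolding f0_def by (rule cls_restrict_card[OF Suc.prems(1)])
    define g where "g A = f A - (\<Sum>B | A \<subseteq> B \<and> B \<subseteq> {..<d}. f0 B)" for A
    have g: "cls g" unfolding g_def by (intro class_fun_diff class_fun_superset_sum f0 Suc.prems)
    have "g A = 0" if A: "A \<subseteq> {..<d}" "k \<le> card A" for A
    proof -
      let ?S = "{B. A \<subseteq> B \<and> B \<subseteq> {..<d}}"
      have fin: "finite ?S" by (rule finite_subset[of _ "Pow {..<d}"]) auto
      have "card A < card B" if "B \<in> ?S - {A}" for B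
        using that by (auto intro!: psubset_card_mono dest: finite_subset)
      then have "f0 B = 0" if "B \<in> ?S - {A}" for B
        using that A(2) unfolding f0_def by (metis not_le)
      then have "(\<Sum>B\<in>?S - {A}. f0 B) = 0" by (rule sum.neutral[OF ballI])
      moreover have "f0 A = f A" using Suc.prems(2)[OF A(1)] A(2) by (auto simp: f0_def)
      ultimately show ?thesis
        unfolding g_def using A(1) sum.remove[OF fin, of A f0] by simp
    qed
    then obtain F where F: "cls F" "\<forall>A\<subseteq>{..<d}. g A = (\<Sum>B | A \<subseteq> B \<and> B \<subseteq> {..<d}. F B)"
      using Suc.IH[OF g] by blast
    show ?case
    proof (intro exI[of _ "\<lambda>A. F A + f0 A"] conjI class_fun_add F(1) f0 allI impI)
      fix A assume "A \<subseteq> {..<d}"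
      then show "f A = (\<Sum>B | A \<subseteq> B \<and> B \<subseteq> {..<d}. F B + f0 B)"
        using F(2) by (simp add: sum.distrib g_def algebra_simps)
    qed
  qed
  moreover have "f A = 0" if "A \<subseteq> {..<d}" "Suc d \<le> card A" for A
    using card_mono[OF _ that(1)] that(2) by simp
  ultimately show ?thesis using assms by blast
qed

text \<open>The converse inversion, again layer by layer: \<open>H\<close> on sets of size \<open>k\<close> is the given subset sum
  minus the subset sum of \<open>H\<close> cut off below \<open>k\<close>.\<close>

lemma cls_of_subset_sums:
  assumes "cls (\<lambda>X. \<Sum>Y | Y \<subseteq> X. H Y)"
  shows "cls H"
proof -
  have "cls (\<lambda>X. if card X < k then H X else 0)" for k
  proof (induction k)
    case 0 then show ?case by (simp add: class_fun_def)
  next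
    case (Suc k)
    let ?H = "\<lambda>X. if card X < k then H X else 0"
    let ?h = "\<lambda>X. (\<Sum>Y | Y \<subseteq> X. H Y) - (\<Sum>Y | Y \<subseteq> X. ?H Y)"
    have h: "?h X = H X" if X: "X \<subseteq> {..<d}" "card X = k" for X
    proof -
      have finX: "finite X" using X(1) finite_subset by blast
      then have fin: "finite {Y. Y \<subseteq> X}" by simp
      have "card Y < k" if "Y \<in> {Y. Y \<subseteq> X} - {X}" for Y
        using that finX X(2) by (auto intro!: psubset_card_mono)
      then have "(\<Sum>Y\<in>{Y. Y \<subseteq> X} - {X}. ?H Y) = (\<Sum>Y\<in>{Y. Y \<subseteq> X} - {X}. H Y)"
        by (intro sum.cong) auto
      then show ?thesis using sum.remove[OF fin, of X H] sum.remove[OF fin, of X ?H] X(2) by simp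
    qed
    have "cls (\<lambda>X. ?H X + (if card X = k then ?h X else 0))"
      by (intro class_fun_add Suc cls_restrict_card[where P="\<lambda>c. c = k"] class_fun_diff assms cls_subset_sum)
    then show ?case
    proof (rule class_fun_cong)
      fix X :: "nat set" assume X: "X \<subseteq> {..<d}"
      show "?H X + (if card X = k then ?h X else 0) = (if card X < Suc k then H X else 0)"
        using h[OF X] by (cases "card X = k") auto
    qed
  qed
  from this[of "Suc d"] show ?thesis
  proof (rule class_fun_cong)
    fix A :: "nat set" assume "A \<subseteq> {..<d}"
    then have "card A < Suc d" using card_mono[of "{..<d}" A] by simp
    then show "(if card A < Suc d then H A else 0) = H A" by simp
  qed
qed

text \<open>Subset sums turn the union-convolution into a pointwise product.\<close>

lemma cls_union_convolution:
  assumes "cls F" "cls G"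
  shows "cls (\<lambda>X. \<Sum>(B, C) | B \<union> C = X. F B * G C)"
proof (rule cls_of_subset_sums)
  have "cls (\<lambda>X. (\<Sum>B | B \<subseteq> X. F B) * (\<Sum>C | C \<subseteq> X. G C))"
    by (intro class_fun_mult cls_subset_sum assms)
  then show "cls (\<lambda>X. \<Sum>Y | Y \<subseteq> X. \<Sum>(B, C) | B \<union> C = Y. F B * G C)"
  proof (rule class_fun_cong)
    fix X :: "nat set" assume "X \<subseteq> {..<d}"
    then have fin: "finite {Y. Y \<subseteq> X}" using finite_subset by fastforce
    have "(\<Sum>B | B \<subseteq> X. F B) * (\<Sum>C | C \<subseteq> X. G C) = (\<Sum>(B,C)\<in>{Y. Y \<subseteq> X}\<times>{Y. Y \<subseteq> X}. F B * G C)"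
      by (simp add: sum_product sum.cartesian_product)
    also have "\<dots> = (\<Sum>Y | Y \<subseteq> X. \<Sum>(B, C) | (B, C) \<in> {Y. Y \<subseteq> X}\<times>{Y. Y \<subseteq> X} \<and> (case (B, C) of (B, C) \<Rightarrow> B \<union> C) = Y. F B * G C)"
      by (subst sum.group[symmetric, of _ "{Y. Y \<subseteq> X}" "\<lambda>(B,C). B \<union> C"]) (use fin in \<open>auto intro!: sum.cong arg_cong2[of _ _ _ _ sum]\<close>)
    also have "\<dots> = (\<Sum>Y | Y \<subseteq> X. \<Sum>(B, C) | B \<union> C = Y. F B * G C)"
      by (intro sum.cong refl arg_cong2[of _ _ _ _ sum]) auto
    finally show "(\<Sum>B | B \<subseteq> X. F B) * (\<Sum>C | C \<subseteq> X. G C) = (\<Sum>Y | Y \<subseteq> X. \<Sum>(B, C) | B \<union> C = Y. F B * G C)" .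
  qed
qed

end

section \<open>Hamming sandwiches\<close>

text \<open>Words of length \<open>d\<close> over the letters \<open>{1..m}\<close>, given by their coordinates, so that the points
  may be natural numbers. The letters start at \<open>1\<close> because \<open>alt_group m\<close> acts on \<open>{1..m}\<close>.\<close>

locale hamming_space =
  fixes V :: "'v set" and coord :: "'v \<Rightarrow> nat \<Rightarrow> nat" and d m :: nat
  assumes coord_in: "\<lbrakk>v \<in> V; i < d\<rbrakk> \<Longrightarrow> coord v i \<in> {1..m}"
    and coord_eqI: "\<lbrakk>u \<in> V; v \<in> V; \<And>i. i < d \<Longrightarrow> coord u i = coord v i\<rbrakk> \<Longrightarrow> u = v"
    and coord_ex: "(\<And>i. i < d \<Longrightarrow> f i \<in> {1..m}) \<Longrightarrow> \<exists>v\<in>V. \<forall>i<d. coord v i = f i"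
    and m3: "m \<ge> 3"
begin

definition diff :: "'v \<Rightarrow> 'v \<Rightarrow> nat set" where
  "diff u v = {i. i < d \<and> coord u i \<noteq> coord v i}"

lemma diff_subset: "diff u v \<subseteq> {..<d}"
  by (auto simp: diff_def)

lemma finite_diff [simp]: "finite (diff u v)"
  by (rule finite_subset[OF diff_subset]) simp

lemma diff_self [simp]: "diff u u = {}"
  by (simp add: diff_def)

lemma diff_commute: "diff u v = diff v u"
  by (auto simp: diff_def)

lemma diff_empty_iff: "u \<in> V \<Longrightarrow> v \<in> V \<Longrightarrow> diff u v = {} \<longleftrightarrow> u = v"
  using coord_eqI by (auto simp: diff_def)

lemma diff_triangle: "diff u w \<subseteq> diff u v \<union> diff v w"
  by (auto simp: diff_def)

lemma bij_coords: "bij_betw (\<lambda>v. restrict (coord v) {..<d}) V ({..<d} \<rightarrow>\<^sub>E {1..m})"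
proof (rule bij_betwI')
  fix u v assume *: "u \<in> V" "v \<in> V"
  show "(restrict (coord u) {..<d} = restrict (coord v) {..<d}) \<longleftrightarrow> u = v"
    using coord_eqI[OF *] by (metis lessThan_iff restrict_apply')
next
  fix v assume "v \<in> V" then show "restrict (coord v) {..<d} \<in> {..<d} \<rightarrow>\<^sub>E {1..m}"
    using coord_in by auto
next
  fix f assume f: "f \<in> {..<d} \<rightarrow>\<^sub>E {1..m}"
  then obtain v where "v \<in> V" "\<forall>i<d. coord v i = f i"
    using coord_ex[of f] by (auto simp: PiE_iff)
  then show "\<exists>v\<in>V. f = restrict (coord v) {..<d}"
    using f by (intro bexI[of _ v] ext) (auto simp: PiE_iff extensional_def)
qed

lemma finite_V: "finite V"
  using bij_betw_finite[OF bij_coords] finite_PiE[of "{..<d}" "\<lambda>_. {1..m}"] by simp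

lemma card_V: "card V = m ^ d"
  using bij_betw_same_card[OF bij_coords] by (simp add: card_PiE)

lemma diff_realised:
  assumes u: "u \<in> V" and A: "A \<subseteq> {..<d}"
  obtains v where "v \<in> V" "diff u v = A"
proof -
  \<comment> \<open>A letter other than that of \<open>u\<close> is put at the positions in \<open>A\<close>.\<close>
  have "\<exists>v\<in>V. \<forall>i<d. coord v i = (if i \<in> A then (if coord u i = 1 then 2 else 1) else coord u i)"
    using m3 coord_in[OF u] by (intro coord_ex) auto
  then obtain v where v: "v \<in> V" "\<forall>i<d. coord v i = (if i \<in> A then (if coord u i = 1 then 2 else 1) else coord u i)"
    by blast
  have "diff u v = A" using A v(2) unfolding diff_def by (auto split: if_splits)
  with v(1) show thesis by (rule that)
qed

lemma V_nonempty: "V \<noteq> {}"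
  using coord_ex[of "\<lambda>_. 1"] m3 by auto

lemma card_box:
  assumes "\<And>i. i < d \<Longrightarrow> S i \<subseteq> {1..m}"
  shows "card {v \<in> V. \<forall>i<d. coord v i \<in> S i} = (\<Prod>i<d. card (S i))"
proof -
  have "bij_betw (\<lambda>v. restrict (coord v) {..<d}) {v \<in> V. \<forall>i<d. coord v i \<in> S i} (Pi\<^sub>E {..<d} S)"
    unfolding bij_betw_def
  proof
    show "inj_on (\<lambda>v. restrict (coord v) {..<d}) {v \<in> V. \<forall>i<d. coord v i \<in> S i}"
      by (rule inj_on_subset[OF bij_betw_imp_inj_on[OF bij_coords]]) auto
    show "(\<lambda>v. restrict (coord v) {..<d}) ` {v \<in> V. \<forall>i<d. coord v i \<in> S i} = Pi\<^sub>E {..<d} S"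
    proof (intro equalityI subsetI)
      fix f assume f: "f \<in> Pi\<^sub>E {..<d} S"
      then obtain v where "v \<in> V" "\<forall>i<d. coord v i = f i"
        using coord_ex[of f] assms by (metis PiE_mem lessThan_iff subsetD)
      then show "f \<in> (\<lambda>v. restrict (coord v) {..<d}) ` {v \<in> V. \<forall>i<d. coord v i \<in> S i}"
        using f by (intro image_eqI[of _ _ v] ext) (auto simp: PiE_iff extensional_def)
    qed (auto split: if_splits)
  qed
  then show ?thesis using bij_betw_same_card by (fastforce simp: card_PiE)
qed

text \<open>The letter at a position outside \<open>B \<inter> C\<close> is forced to agree with \<open>u\<close> or \<open>v\<close>, and at the
  positions in \<open>B \<inter> C\<close> it is free.\<close>

lemma card_between:
  assumes uv: "u \<in> V" "v \<in> V" and BC: "B \<subseteq> {..<d}" "C \<subseteq> {..<d}"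
  shows "card {w \<in> V. diff u w \<subseteq> B \<and> diff w v \<subseteq> C} =
    (if diff u v \<subseteq> B \<union> C then m ^ card (B \<inter> C) else 0)"
proof (cases "diff u v \<subseteq> B \<union> C")
  case True
  define S where "S i = (if i \<in> B then if i \<in> C then {1..m} else {coord v i} else {coord u i})" for i
  have "{w \<in> V. diff u w \<subseteq> B \<and> diff w v \<subseteq> C} = {w \<in> V. \<forall>i<d. coord w i \<in> S i}"
  proof (intro Collect_cong conj_cong refl)
    fix w assume w: "w \<in> V"
    have "(i \<in> diff u w \<longrightarrow> i \<in> B) \<and> (i \<in> diff w v \<longrightarrow> i \<in> C) \<longleftrightarrow> coord w i \<in> S i" if "i < d" for i
      using True coord_in[OF w that] that by (auto simp: S_def diff_def)
    then show "diff u w \<subseteq> B \<and> diff w v \<subseteq> C \<longleftrightarrow> (\<forall>i<d. coord w i \<in> S i)"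
      using diff_subset by blast
  qed
  also have "card \<dots> = (\<Prod>i<d. card (S i))"
    by (rule card_box) (use coord_in uv in \<open>auto simp: S_def\<close>)
  also have "\<dots> = (\<Prod>i<d. if i \<in> B \<inter> C then m else 1)"
    by (intro prod.cong) (auto simp: S_def)
  also have "\<dots> = m ^ card (B \<inter> C)"
  proof -
    have "{..<d} \<inter> {i. i \<in> B \<and> i \<in> C} = B \<inter> C" using BC by auto
    then show ?thesis by (simp add: prod.If_cases)
  qed
  finally show ?thesis using True by simp
next
  case False
  then have "{w \<in> V. diff u w \<subseteq> B \<and> diff w v \<subseteq> C} = {}"
    using diff_triangle[of u v] by blast
  then have "card {w \<in> V. diff u w \<subseteq> B \<and> diff w v \<subseteq> C} = 0" by (simp only: card.empty)
  then show ?thesis using False by simp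
qed

end

text \<open>Singletons having one type means that the relations do not distinguish single coordinates.\<close>

locale hamming_sandwich = hamming_space V coord d m + equitable_typing d ty
  for V :: "'v set" and coord :: "'v \<Rightarrow> nat \<Rightarrow> nat" and d m :: nat and ty :: "nat set \<Rightarrow> 't" +
  assumes ty_singleton: "\<lbrakk>i < d; j < d\<rbrakk> \<Longrightarrow> ty {i} = ty {j}"
begin

definition rel_of :: "'t \<Rightarrow> 'v rel" where
  "rel_of t = {(u, v). u \<in> V \<and> v \<in> V \<and> ty (diff u v) = t}"

definition sandwich :: "'v rel set" where
  "sandwich = rel_of ` ty ` Pow {..<d}"

lemma rel_of_nonempty:
  assumes "t \<in> ty ` Pow {..<d}" shows "rel_of t \<noteq> {}"
proof -
  obtain A where A: "A \<subseteq> {..<d}" "t = ty A" using assms by auto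
  obtain u where u: "u \<in> V" using V_nonempty by blast
  obtain v where "v \<in> V" "diff u v = A" using diff_realised[OF u A(1)] .
  then show ?thesis using u A(2) unfolding rel_of_def by auto
qed

lemma inj_rel_of: "inj_on rel_of (ty ` Pow {..<d})"
proof (rule inj_onI)
  fix s t assume st: "s \<in> ty ` Pow {..<d}" "t \<in> ty ` Pow {..<d}" "rel_of s = rel_of t"
  then obtain u v where "(u, v) \<in> rel_of s" using rel_of_nonempty[OF st(1)] by auto
  with st(3) show "s = t" unfolding rel_of_def by auto
qed

lemma card_sandwich: "card sandwich = card (ty ` Pow {..<d})"
  unfolding sandwich_def by (rule card_image[OF inj_rel_of])

lemma in_rel_of_diff: "u \<in> V \<Longrightarrow> v \<in> V \<Longrightarrow> (u, v) \<in> rel_of (ty (diff u v))"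
  by (simp add: rel_of_def)

lemma rel_of_in_sandwich: "A \<subseteq> {..<d} \<Longrightarrow> rel_of (ty A) \<in> sandwich"
  unfolding sandwich_def by blast

lemma ty_empty_iff: "A \<subseteq> {..<d} \<Longrightarrow> ty A = ty {} \<longleftrightarrow> A = {}"
  using ty_card[of A "{}"] finite_subset[of A "{..<d}"] by auto

lemma rel_of_empty: "rel_of (ty {}) = Id_on V"
  unfolding rel_of_def Id_on_def using ty_empty_iff[OF diff_subset] diff_empty_iff by auto

lemma converse_rel_of: "(rel_of t)\<inverse> = rel_of t"
  unfolding rel_of_def using diff_commute by auto

lemma homogeneous_sandwich: "homogeneous V sandwich"
  unfolding homogeneous_def using rel_of_in_sandwich[of "{}"] rel_of_empty by simp

lemma symmetric_sandwich: "symmetric sandwich"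
  unfolding symmetric_def sandwich_def using converse_rel_of by auto

lemma configuration_sandwich: "configuration V sandwich"
  unfolding configuration_def
proof (intro conjI)
  show "partition_on (V \<times> V) sandwich"
  proof (rule partition_onI)
    show "\<Union>sandwich = V \<times> V"
    proof (intro equalityI subsetI)
      fix p assume "p \<in> V \<times> V"
      then show "p \<in> \<Union>sandwich"
        using in_rel_of_diff rel_of_in_sandwich[OF diff_subset] by (cases p) blast
    qed (auto simp: sandwich_def rel_of_def)
    show "{} \<notin> sandwich"
      using rel_of_nonempty unfolding sandwich_def by (metis imageE)
    show "disjnt p q" if "p \<in> sandwich" "q \<in> sandwich" "p \<noteq> q" for p q
      using that unfolding sandwich_def rel_of_def disjnt_def by auto
  qed
  have "partition_on (Id_on V) {Id_on V}"
    using V_nonempty by (intro partition_onI) auto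
  then show "\<exists>D\<subseteq>sandwich. partition_on (Id_on V) D"
    using homogeneous_sandwich unfolding homogeneous_def by blast
  show "\<forall>R\<in>sandwich. R\<inverse> \<in> sandwich"
    using symmetric_sandwich unfolding symmetric_def by simp
qed (rule finite_V)

text \<open>Both factors are expanded into indicators of \<open>diff u w \<subseteq> B\<close> and \<open>diff w v \<subseteq> C\<close>. As
  \<open>m ^ card (B \<inter> C) = m ^ card B * m ^ card C / m ^ card (B \<union> C)\<close>, the remaining sum over \<open>B\<close> and
  \<open>C\<close> is a union-convolution of class functions, followed by a sum over the supersets of
  \<open>diff u v\<close>.\<close>

lemma convolution_class_fun:
  assumes "cls f" "cls g"
  shows "\<exists>h. cls h \<and> (\<forall>u\<in>V. \<forall>v\<in>V. (\<Sum>w\<in>V. f (diff u w) * g (diff w v)) = h (diff u v))"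
proof -
  let ?P = "Pow {..<d}"
  obtain F where F: "cls F" "\<forall>A\<subseteq>{..<d}. f A = (\<Sum>B | A \<subseteq> B \<and> B \<subseteq> {..<d}. F B)"
    using cls_superset_inversion[OF assms(1)] by blast
  obtain G where G: "cls G" "\<forall>A\<subseteq>{..<d}. g A = (\<Sum>B | A \<subseteq> B \<and> B \<subseteq> {..<d}. G B)"
    using cls_superset_inversion[OF assms(2)] by blast
  \<comment> \<open>The factor \<open>m ^ card (B \<inter> C)\<close> is split into a part depending on \<open>B\<close>, one on \<open>C\<close>, and one on
    \<open>B \<union> C\<close>, which \<open>H\<close> divides off.\<close>
  define F' where "F' B = F B * real m ^ card B" for B
  define G' where "G' B = G B * real m ^ card B" for B
  define H where "H X = (\<Sum>(B, C) | B \<union> C = X. F' B * G' C) / real m ^ card X" for X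
  have F': "cls F'" "cls G'" unfolding F'_def G'_def
    by (intro class_fun_mult F G cls_card[where h="\<lambda>k. real m ^ k"])+
  have H: "cls H" unfolding H_def divide_inverse
    by (intro class_fun_mult cls_union_convolution F' cls_card[where h="\<lambda>k. inverse (real m ^ k)"])
  have sup: "(\<Sum>B | A \<subseteq> B \<and> B \<subseteq> {..<d}. k B) = (\<Sum>B\<in>?P. if A \<subseteq> B then k B else 0)"
    for A and k :: "nat set \<Rightarrow> real"
  proof -
    have *: "{B. A \<subseteq> B \<and> B \<subseteq> {..<d}} = {B \<in> ?P. A \<subseteq> B}" by auto
    show ?thesis unfolding * by (rule sum.inter_filter) simp
  qed
  show ?thesis
  proof (rule exI[of _ "\<lambda>A. \<Sum>X | A \<subseteq> X \<and> X \<subseteq> {..<d}. H X"], intro conjI ballI)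
    show "cls (\<lambda>A. \<Sum>X | A \<subseteq> X \<and> X \<subseteq> {..<d}. H X)" by (rule class_fun_superset_sum[OF H])
  next
    fix u v assume uv: "u \<in> V" "v \<in> V"
    have "(\<Sum>w\<in>V. f (diff u w) * g (diff w v)) =
      (\<Sum>w\<in>V. (\<Sum>B\<in>?P. if diff u w \<subseteq> B then F B else 0) * (\<Sum>C\<in>?P. if diff w v \<subseteq> C then G C else 0))"
      using F(2) G(2) diff_subset by (simp only: sup)
    also have "\<dots> = (\<Sum>w\<in>V. \<Sum>(B,C)\<in>?P\<times>?P. if diff u w \<subseteq> B \<and> diff w v \<subseteq> C then F B * G C else 0)"
      unfolding sum_product sum.cartesian_product by (intro sum.cong refl) auto
    also have "\<dots> = (\<Sum>(B,C)\<in>?P\<times>?P. \<Sum>w\<in>V. if diff u w \<subseteq> B \<and> diff w v \<subseteq> C then F B * G C else 0)"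
      by (subst sum.swap) (simp add: split_def)
    also have "\<dots> = (\<Sum>(B,C)\<in>?P\<times>?P. F B * G C * card {w \<in> V. diff u w \<subseteq> B \<and> diff w v \<subseteq> C})"
      using finite_V by (intro sum.cong refl) (simp add: split_def sum.If_cases Int_def)
    also have "\<dots> = (\<Sum>(B,C)\<in>?P\<times>?P. if diff u v \<subseteq> B \<union> C then F B * G C * real m ^ card (B \<inter> C) else 0)"
      using uv by (intro sum.cong refl) (auto simp: card_between)
    also have "\<dots> = (\<Sum>(B,C)\<in>?P\<times>?P. if diff u v \<subseteq> B \<union> C then F' B * G' C / real m ^ card (B \<union> C) else 0)"
    proof (intro sum.cong refl)
      fix p assume "p \<in> ?P \<times> ?P"
      then obtain B C where p: "p = (B, C)" "finite B" "finite C"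
        by (auto dest: finite_subset[OF _ finite_lessThan])
      have "real m ^ card B * real m ^ card C = real m ^ card (B \<union> C) * real m ^ card (B \<inter> C)"
        using card_Un_Int[OF p(2,3)] by (metis power_add)
      moreover have "real m ^ card (B \<union> C) \<noteq> 0" using m3 by simp
      ultimately have "real m ^ card (B \<inter> C) = real m ^ card B * real m ^ card C / real m ^ card (B \<union> C)"
        by (simp add: field_simps)
      then show "(case p of (B, C) \<Rightarrow> if diff u v \<subseteq> B \<union> C then F B * G C * real m ^ card (B \<inter> C) else 0) =
         (case p of (B, C) \<Rightarrow> if diff u v \<subseteq> B \<union> C then F' B * G' C / real m ^ card (B \<union> C) else 0)"
        by (simp add: p(1) F'_def G'_def)
    qed
    also have "\<dots> = (\<Sum>X\<in>?P. \<Sum>(B,C) | (B, C) \<in> ?P\<times>?P \<and> (case (B, C) of (B, C) \<Rightarrow> B \<union> C) = X.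
        if diff u v \<subseteq> B \<union> C then F' B * G' C / real m ^ card (B \<union> C) else 0)"
      by (subst sum.group[symmetric, of _ ?P "\<lambda>(B,C). B \<union> C"]) (auto intro!: sum.cong arg_cong2[of _ _ _ _ sum])
    also have "\<dots> = (\<Sum>X\<in>?P. if diff u v \<subseteq> X then H X else 0)"
    proof (intro sum.cong refl)
      fix X assume X: "X \<in> ?P"
      have "{(B, C). (B, C) \<in> ?P\<times>?P \<and> (case (B, C) of (B, C) \<Rightarrow> B \<union> C) = X} = {(B, C). B \<union> C = X}"
        using X by auto
      moreover have "(\<Sum>(B,C) | B \<union> C = X. if diff u v \<subseteq> B \<union> C then F' B * G' C / real m ^ card (B \<union> C) else 0) =
         (\<Sum>(B,C) | B \<union> C = X. if diff u v \<subseteq> X then F' B * G' C / real m ^ card X else 0)"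
        by (intro sum.cong refl) auto
      ultimately show "(\<Sum>(B,C) | (B, C) \<in> ?P\<times>?P \<and> (case (B, C) of (B, C) \<Rightarrow> B \<union> C) = X.
        if diff u v \<subseteq> B \<union> C then F' B * G' C / real m ^ card (B \<union> C) else 0) = (if diff u v \<subseteq> X then H X else 0)"
        by (simp add: H_def sum_divide_distrib split_def)
    qed
    also have "\<dots> = (\<Sum>X | diff u v \<subseteq> X \<and> X \<subseteq> {..<d}. H X)"
      by (simp only: sup)
    finally show "(\<Sum>w\<in>V. f (diff u w) * g (diff w v)) = (\<Sum>X | diff u v \<subseteq> X \<and> X \<subseteq> {..<d}. H X)" .
  qed
qed

lemma coherent_sandwich: "coherent V sandwich"
proof -
  define N where "N Rj Rk u v = card {w \<in> V. (u, w) \<in> Rj \<and> (w, v) \<in> Rk}" for Rj Rk :: "'v rel" and u v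
  have N: "N Rj Rk u v = N Rj Rk u' v'"
    if R: "Ri \<in> sandwich" "Rj \<in> sandwich" "Rk \<in> sandwich" "(u, v) \<in> Ri" "(u', v') \<in> Ri" for Ri Rj Rk u v u' v'
  proof -
    obtain s t where st: "Rj = rel_of s" "Rk = rel_of t"
      using R(2,3) unfolding sandwich_def by blast
    have uv: "u \<in> V" "v \<in> V" "u' \<in> V" "v' \<in> V" "ty (diff u v) = ty (diff u' v')"
      using R(1,4,5) unfolding sandwich_def rel_of_def by auto
    have "cls (\<lambda>A. of_bool (ty A = s))" "cls (\<lambda>A. of_bool (ty A = t))"
      by (rule class_fun_type)+
    then obtain h where h: "cls h"
      "\<forall>u\<in>V. \<forall>v\<in>V. (\<Sum>w\<in>V. of_bool (ty (diff u w) = s) * of_bool (ty (diff w v) = t)) = h (diff u v)"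
      using convolution_class_fun by blast
    have "real (N Rj Rk u v) = h (diff u v)" if "u \<in> V" "v \<in> V" for u v
    proof -
      have "real (N Rj Rk u v) = (\<Sum>w\<in>V. of_bool (ty (diff u w) = s \<and> ty (diff w v) = t))"
        using that finite_V unfolding N_def st rel_of_def by (simp add: Int_def conj_ac)
      also have "\<dots> = h (diff u v)" using h(2) that by (simp add: of_bool_conj)
      finally show ?thesis .
    qed
    then have "real (N Rj Rk u v) = real (N Rj Rk u' v')"
      using uv class_funD[OF h(1) diff_subset diff_subset uv(5)] by metis
    then show ?thesis by simp
  qed
  show ?thesis unfolding coherent_def N_def[symmetric]
  proof (intro exI ballI)
    fix Ri Rj Rk assume R: "Ri \<in> sandwich" "Rj \<in> sandwich" "Rk \<in> sandwich"
    fix p assume "p \<in> Ri"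
    then obtain u v where p: "p = (u, v)" "(u, v) \<in> Ri" by (cases p) auto
    have "N Rj Rk u v = (case SOME p. p \<in> Ri of (u, v) \<Rightarrow> N Rj Rk u v)"
      using N[OF R p(2)] someI[of "\<lambda>p. p \<in> Ri", OF p(2)] by (auto split: prod.split)
    then show "case p of (u, v) \<Rightarrow> N Rj Rk u v = (\<lambda>Ri Rj Rk. case SOME p. p \<in> Ri of (u, v) \<Rightarrow> N Rj Rk u v) Ri Rj Rk"
      using p(1) by simp
  qed
qed

lemma association_scheme_sandwich: "association_scheme V sandwich"
  unfolding association_scheme_def
  using configuration_sandwich coherent_sandwich homogeneous_sandwich symmetric_sandwich by blast

text \<open>The number of sets of a given type above a singleton is a class function, hence the same for all
  singletons.\<close>

lemma type_covers:
  assumes A: "A \<subseteq> {..<d}" "A \<noteq> {}" and i: "i < d"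
  obtains B where "B \<subseteq> {..<d}" "ty B = ty A" "i \<in> B"
proof -
  obtain j where j: "j \<in> A" "j < d" using A by auto
  let ?S = "\<lambda>i. \<Sum>B | {i} \<subseteq> B \<and> B \<subseteq> {..<d}. of_bool (ty B = ty A) :: real"
  have "?S i = ?S j"
    using class_funD[OF class_fun_superset_sum[OF class_fun_type[where h="\<lambda>t. of_bool (t = ty A)"]], of "{i}" "{j}"]
      ty_singleton[OF i j(2)] i j(2) by simp
  moreover have "?S j > 0"
    by (rule sum_pos2[of _ A]) (use A j in \<open>auto intro: finite_subset[of _ "Pow {..<d}"]\<close>)
  ultimately have "?S i \<noteq> 0" by linarith
  then obtain B where "B \<in> {B. {i} \<subseteq> B \<and> B \<subseteq> {..<d}}" "of_bool (ty B = ty A) \<noteq> (0::real)"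
    by (rule sum.not_neutral_contains_not_neutral)
  then show thesis using that by auto
qed

text \<open>With a third letter available at every position of a set \<open>B\<close> of the given type that contains \<open>i\<close>,
  there is a word that differs from both \<open>u\<close> and \<open>v\<close> exactly on \<open>B\<close>.\<close>

lemma two_steps_change_one_coordinate:
  assumes A: "A \<subseteq> {..<d}" "A \<noteq> {}" and uv: "u \<in> V" "v \<in> V" "diff u v = {i}"
  shows "(u, v) \<in> (rel_of (ty A))\<^sup>*"
proof -
  have i: "i < d" using uv(3) diff_subset by blast
  obtain B where B: "B \<subseteq> {..<d}" "ty B = ty A" "i \<in> B" using type_covers[OF A i] .
  have third: "\<exists>z. z \<in> {1..m} \<and> z \<noteq> x \<and> z \<noteq> y" for x y
  proof -
    have "\<not> {1..m} \<subseteq> {x, y}"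
      using card_mono[of "{x,y}" "{1..m}"] m3 card_insert_le_m1[of 2 "{y}" x] by auto
    then show ?thesis by blast
  qed
  define z where "z j = (SOME z. z \<in> {1..m} \<and> z \<noteq> coord u j \<and> z \<noteq> coord v j)" for j
  have z: "z j \<in> {1..m}" "z j \<noteq> coord u j" "z j \<noteq> coord v j" for j
    using someI_ex[OF third[of "coord u j" "coord v j"]] unfolding z_def by blast+
  obtain w where w: "w \<in> V" "\<forall>j<d. coord w j = (if j \<in> B then z j else coord u j)"
    using coord_ex[of "\<lambda>j. if j \<in> B then z j else coord u j"] z(1) coord_in[OF uv(1)]
    by (metis (full_types))
  have eq: "coord u j = coord v j" if "j < d" "j \<noteq> i" for j
    using uv(3) that unfolding diff_def by blast
  have "j \<in> diff u w \<longleftrightarrow> j \<in> B" for j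
    using w(2) z(2)[of j] B(1) by (cases "j < d") (auto simp: diff_def)
  then have "diff u w = B" by blast
  moreover have "j \<in> diff w v \<longleftrightarrow> j \<in> B" for j
    using w(2) z(3)[of j] B(1,3) eq[of j]
    by (cases "j < d"; cases "j = i"; cases "j \<in> B") (auto simp: diff_def)
  then have "diff w v = B" by blast
  ultimately have "(u, w) \<in> rel_of (ty A)" "(w, v) \<in> rel_of (ty A)"
    using in_rel_of_diff[OF uv(1) w(1)] in_rel_of_diff[OF w(1) uv(2)] B(2) by auto
  then show ?thesis by (meson r_into_rtrancl rtrancl.rtrancl_into_rtrancl)
qed

end

context hamming_space
begin

text \<open>A word is reached from another one by changing one coordinate at a time.\<close>

lemma diff_induct [consumes 2, case_names refl step]:
  assumes u: "u \<in> V" and v: "v \<in> V"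
    and refl: "P u"
    and step: "\<And>v w i. \<lbrakk>v \<in> V; w \<in> V; i < d; diff v w = {i}; diff u w = insert i (diff u v); i \<notin> diff u v; P v\<rbrakk> \<Longrightarrow> P w"
  shows "P v"
  using v
proof (induction "card (diff u v)" arbitrary: v)
  case 0
  then show ?case using refl u diff_empty_iff by auto
next
  case (Suc k)
  then obtain i where i: "i \<in> diff u v" by fastforce
  then have id: "i < d" using diff_subset by blast
  obtain w where w: "w \<in> V" "\<forall>j<d. coord w j = ((coord v)(i := coord u i)) j"
    using coord_ex[of "(coord v)(i := coord u i)"] coord_in[OF Suc.prems] coord_in[OF u]
    by (metis fun_upd_apply)
  have uw: "diff u w = diff u v - {i}" using w(2) by (auto simp: diff_def split: if_splits)
  moreover have "diff w v = {i}" using w(2) i id by (auto simp: diff_def split: if_splits)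
  ultimately show ?case
    using step[of w v i] Suc.hyps(1)[of w] Suc.hyps(2) w(1) i id Suc.prems by (simp add: insert_absorb)
qed

end

context hamming_sandwich
begin

lemma primitive_sandwich: "primitive_configuration V sandwich"
  unfolding primitive_configuration_def
proof (intro conjI ballI impI configuration_sandwich coherent_sandwich homogeneous_sandwich)
  fix R u v assume R: "R \<in> sandwich" "R \<noteq> Id_on V" and uv: "u \<in> V" "v \<in> V"
  obtain A where A: "A \<subseteq> {..<d}" "R = rel_of (ty A)" using R(1) unfolding sandwich_def by blast
  then have "A \<noteq> {}" using R(2) rel_of_empty by auto
  show "(u, v) \<in> R\<^sup>*" using uv
  proof (induction rule: diff_induct)
    case (step v w i)
    then show ?case
      using two_steps_change_one_coordinate[OF A(1) \<open>A \<noteq> {}\<close>, of v w i] A(2) by (metis rtrancl_trans)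
  qed simp
qed

end

section \<open>Automorphisms of Hamming sandwiches\<close>

context hamming_space
begin

lemma diff_eq_pair:
  assumes "diff u v = {j}" "diff u w = {k}" "j \<noteq> k"
  shows "diff v w = {j, k}"
proof -
  have "i \<in> diff v w \<longleftrightarrow> i = j \<or> i = k" for i
  proof -
    have "(i < d \<and> coord u i \<noteq> coord v i) \<longleftrightarrow> i = j" "(i < d \<and> coord u i \<noteq> coord w i) \<longleftrightarrow> i = k"
      using assms(1,2) unfolding diff_def by blast+
    then show ?thesis using assms(3) by (cases "i = j"; cases "i = k") (auto simp: diff_def)
  qed
  then show ?thesis by blast
qed

text \<open>An isometry sends words that differ only at \<open>i\<close> to words that differ only at some \<open>j\<close>. Here \<open>j\<close>
  depends on \<open>u\<close> and \<open>i\<close> only, since three words on a line are sent to a triangle of neighbours;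
  and it is the same for adjacent \<open>u\<close>, since a square of the Hamming graph is sent to a square.
  Hence \<open>j = \<pi> i\<close> with one permutation \<open>\<pi>\<close>.\<close>

lemma isometry_direction:
  assumes g: "g permutes V"
    and iso: "\<And>u v. u \<in> V \<Longrightarrow> v \<in> V \<Longrightarrow> card (diff (g u) (g v)) = card (diff u v)"
  shows "\<exists>\<pi>. \<pi> permutes {..<d} \<and> (\<forall>u\<in>V. \<forall>v\<in>V. diff (g u) (g v) = \<pi> ` diff u v)"
proof -
  have gV: "g u \<in> V" if "u \<in> V" for u using that permutes_in_image[OF g] by simp
  \<comment> \<open>\<open>E u i j\<close>: a change of \<open>u\<close> at \<open>i\<close> is turned into a change of \<open>g u\<close> at \<open>j\<close>.\<close>
  define E where "E u i j \<longleftrightarrow> (\<forall>v\<in>V. diff u v = {i} \<longrightarrow> diff (g u) (g v) = {j})" for u i j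
  have single: "\<exists>j. diff (g u) (g v) = {j}" if "u \<in> V" "v \<in> V" "diff u v = {i}" for u v i
    using iso[OF that(1,2)] that(3) by (simp add: card_1_singleton_iff)
  have E_ex: "\<exists>j. E u i j" if u: "u \<in> V" and i: "i < d" for u i
  proof -
    obtain v where v: "v \<in> V" "diff u v = {i}" using diff_realised[OF u, of "{i}"] i by auto
    obtain j where j: "diff (g u) (g v) = {j}" using single[OF u v] by blast
    have "diff (g u) (g w) = {j}" if w: "w \<in> V" "diff u w = {i}" for w
    proof -
      obtain k where k: "diff (g u) (g w) = {k}" using single[OF u w] by blast
      have "diff v w \<subseteq> {i}" using v(2) w(2) diff_triangle[of v w u] diff_commute[of v u] by auto
      then have "card (diff (g v) (g w)) \<le> 1"
        using iso[OF v(1) w(1)] card_mono[of "{i}" "diff v w"] by simp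
      then have "j = k" using diff_eq_pair[OF j k] by (cases "j = k") auto
      then show ?thesis using k by simp
    qed
    then show ?thesis unfolding E_def by blast
  qed
  have E_unique: "j = j'" if "u \<in> V" "i < d" "E u i j" "E u i j'" for u i j j'
    using diff_realised[of u "{i}"] that unfolding E_def by (metis empty_subsetI insert_subset lessThan_iff singleton_inject)
  have E_inj: "j \<noteq> k" if u: "u \<in> V" and E: "E u i j" "E u l k" and il: "i < d" "l < d" "i \<noteq> l" for u i l j k
  proof
    assume "j = k"
    obtain v where v: "v \<in> V" "diff u v = {i}" using diff_realised[OF u, of "{i}"] il by auto
    obtain w where w: "w \<in> V" "diff u w = {l}" using diff_realised[OF u, of "{l}"] il by auto
    have "diff v w = {i, l}" using diff_eq_pair[OF v(2) w(2) il(3)] .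
    then have "card (diff (g v) (g w)) = 2" using iso[OF v(1) w(1)] il(3) by simp
    moreover have "diff (g v) (g w) \<subseteq> {j}"
      using E v w \<open>j = k\<close> diff_triangle[of "g v" "g w" "g u"] diff_commute[of "g v" "g u"]
      unfolding E_def by auto
    ultimately show False using card_mono[of "{j}" "diff (g v) (g w)"] by simp
  qed
  have E_adj: "j = j'"
    if u: "u \<in> V" and u': "u' \<in> V" and k: "diff u u' = {k}" and i: "i < d" and E: "E u i j" "E u' i j'"
    for u u' i k j j'
  proof (cases "k = i")
    case True
    then have "diff (g u) (g u') = {j}" "diff (g u') (g u) = {j'}"
      using E u u' k diff_commute[of u' u] unfolding E_def by auto
    then show ?thesis using diff_commute[of "g u" "g u'"] by simp
  next
    case False
    obtain v where v: "v \<in> V" "diff u v = {i}" using diff_realised[OF u, of "{i}"] i by auto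
    \<comment> \<open>The words \<open>u\<close>, \<open>v\<close>, \<open>v'\<close>, \<open>u'\<close> form a square with sides in the directions \<open>i\<close> and \<open>k\<close>.\<close>
    have "\<exists>v'\<in>V. \<forall>l<d. coord v' l = ((coord u')(i := coord v i)) l"
      using coord_in[OF u'] coord_in[OF v(1)] by (intro coord_ex) auto
    then obtain v' where v': "v' \<in> V" "\<And>l. l < d \<Longrightarrow> coord v' l = ((coord u')(i := coord v i)) l"
      by blast
    have uv': "diff u' v' = {i}"
    proof -
      have "i \<notin> diff u u'" "i \<in> diff u v" using k v(2) False by simp_all
      then have "coord u' i = coord u i" "coord u i \<noteq> coord v i" using i by (simp_all add: diff_def)
      then have "l \<in> diff u' v' \<longleftrightarrow> l = i" for l
        using v'(2)[of l] i by (cases "l = i") (auto simp: diff_def)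
      then show ?thesis by blast
    qed
    have vv': "diff v v' = {k}"
    proof -
      have "l \<in> diff v v' \<longleftrightarrow> l \<in> diff u u'" if "l \<noteq> i" for l
      proof -
        have "l \<in> diff u v \<longleftrightarrow> l = i" using v(2) by simp
        then have "(l < d \<and> coord u l \<noteq> coord v l) \<longleftrightarrow> l = i" by (simp add: diff_def)
        then show ?thesis using v'(2)[of l] that by (cases "l < d") (auto simp: diff_def)
      qed
      moreover have "i \<notin> diff v v'" using v'(2)[OF i] unfolding diff_def by simp
      ultimately have "l \<in> diff v v' \<longleftrightarrow> l = k" for l
        using k False by (cases "l = i") auto
      then show ?thesis by blast
    qed
    have j: "diff (g u) (g v) = {j}" "diff (g u') (g v') = {j'}" using E v v' uv' unfolding E_def by auto
    obtain l where l: "diff (g u) (g u') = {l}" using single[OF u u' k] by blast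
    obtain l' where l': "diff (g v) (g v') = {l'}" using single[OF v(1) v'(1) vv'] by blast
    \<comment> \<open>Both diagonals keep their length, which leaves only parallel opposite sides for the image.\<close>
    have "diff v u' = {i, k}" using diff_eq_pair[OF v(2) k] False by auto
    then have "card (diff (g v) (g u')) = 2" using iso[OF v(1) u'] False by simp
    moreover have "diff (g v) (g u') \<subseteq> {j, l}"
      using diff_triangle[of "g v" "g u'" "g u"] diff_commute[of "g v" "g u"] j(1) l by auto
    ultimately have jl: "j \<noteq> l" using card_mono[of "{j, l}" "diff (g v) (g u')"] by auto
    have "diff u v' = {i, k}"
      using diff_eq_pair[of v u i v' k] v(2) vv' False diff_commute[of v u] by auto
    then have "card (diff (g u) (g v')) = 2" using iso[OF u v'(1)] False by simp
    moreover have "diff (g u) (g v') \<subseteq> {l, j'}" "diff (g u) (g v') \<subseteq> {j, l'}"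
      using diff_triangle[of "g u" "g v'" "g u'"] diff_triangle[of "g u" "g v'" "g v"] j l l' by auto
    ultimately have "{l, j'} = {j, l'}"
      using card_seteq[of "{l, j'}" "diff (g u) (g v')"] card_seteq[of "{j, l'}" "diff (g u) (g v')"]
        card_insert_le_m1[of 2 "{j'}" l] card_insert_le_m1[of 2 "{l'}" j] by auto
    then show ?thesis using jl by auto
  qed
  obtain u0 where u0: "u0 \<in> V" using V_nonempty by blast
  define \<pi> where "\<pi> i = (if i < d then (SOME j. E u0 i j) else i)" for i
  have \<pi>0: "E u0 i (\<pi> i)" if "i < d" for i
    using someI_ex[OF E_ex[OF u0 that]] that unfolding \<pi>_def by simp
  have \<pi>: "E u i (\<pi> i)" if "u \<in> V" "i < d" for u i
    using u0 that(1)
  proof (induction rule: diff_induct)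
    case refl show ?case by (rule \<pi>0[OF that(2)])
  next
    case (step v w k)
    then show ?case using E_ex[OF step(2) that(2)] E_adj[OF step(1,2,4) that(2)] by metis
  qed
  have \<pi>_lt: "\<pi> i < d" if i: "i < d" for i
  proof -
    obtain v where "v \<in> V" "diff u0 v = {i}" using diff_realised[OF u0, of "{i}"] i by auto
    then have "diff (g u0) (g v) = {\<pi> i}" using \<pi>0[OF i] unfolding E_def by blast
    then show ?thesis using diff_subset[of "g u0" "g v"] by simp
  qed
  have inj: "inj_on \<pi> {..<d}"
    by (rule inj_onI) (metis E_inj[OF u0] \<pi>0 lessThan_iff)
  have "\<pi> ` {..<d} = {..<d}"
    using \<pi>_lt by (intro endo_inj_surj[OF _ _ inj]) auto
  then have perm: "\<pi> permutes {..<d}"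
    using inj by (intro bij_imp_permutes) (auto simp: bij_betw_def \<pi>_def)
  \<comment> \<open>One inclusion follows along a path from \<open>u\<close> to \<open>v\<close>; the cardinalities give equality.\<close>
  have sub: "diff (g u) (g v) \<subseteq> \<pi> ` diff u v" if "u \<in> V" "v \<in> V" for u v
    using that
  proof (induction rule: diff_induct)
    case (step v w i)
    then have "diff (g v) (g w) = {\<pi> i}" using \<pi>[of v i] unfolding E_def by blast
    then show ?case using step diff_triangle[of "g u" "g w" "g v"] by auto
  qed simp
  have "diff (g u) (g v) = \<pi> ` diff u v" if "u \<in> V" "v \<in> V" for u v
    using sub[OF that] iso[OF that] card_image[OF inj_on_subset[OF inj diff_subset], of u v]
    by (intro card_subset_eq) auto
  then show ?thesis using perm by blast
qed

text \<open>The letter at position \<open>i\<close> is permuted by \<open>\<sigma> i\<close> and then moved to position \<open>\<pi> i\<close>.\<close>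

definition wreath :: "(nat \<Rightarrow> nat) \<Rightarrow> (nat \<Rightarrow> nat \<Rightarrow> nat) \<Rightarrow> 'v \<Rightarrow> 'v" where
  "wreath \<pi> \<sigma> u = (if u \<in> V then SOME v. v \<in> V \<and> (\<forall>i<d. coord v (\<pi> i) = \<sigma> i (coord u i)) else u)"

lemma wreath_props:
  assumes \<pi>: "\<pi> permutes {..<d}" and \<sigma>: "\<forall>i<d. \<sigma> i permutes {1..m}" and u: "u \<in> V"
  shows wreath_in: "wreath \<pi> \<sigma> u \<in> V"
    and wreath_coord: "\<And>i. i < d \<Longrightarrow> coord (wreath \<pi> \<sigma> u) (\<pi> i) = \<sigma> i (coord u i)"
proof -
  have "\<exists>v\<in>V. \<forall>j<d. coord v j = \<sigma> (inv' \<pi> j) (coord u (inv' \<pi> j))"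
  proof (rule coord_ex)
    fix j assume "j < d"
    then have "inv' \<pi> j < d" using permutes_in_image[OF permutes_inv[OF \<pi>]] by simp
    then show "\<sigma> (inv' \<pi> j) (coord u (inv' \<pi> j)) \<in> {1..m}"
      using permutes_in_image[OF \<sigma>[rule_format]] coord_in[OF u] by blast
  qed
  then obtain v where v: "v \<in> V" "\<forall>j<d. coord v j = \<sigma> (inv' \<pi> j) (coord u (inv' \<pi> j))" by blast
  have "coord v (\<pi> i) = \<sigma> i (coord u i)" if "i < d" for i
    using v(2) that permutes_in_image[OF \<pi>, of i] by (simp add: permutes_inverses(2)[OF \<pi>])
  then have "\<exists>v. v \<in> V \<and> (\<forall>i<d. coord v (\<pi> i) = \<sigma> i (coord u i))" using v(1) by blast
  from someI_ex[OF this] show "wreath \<pi> \<sigma> u \<in> V"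
    "\<And>i. i < d \<Longrightarrow> coord (wreath \<pi> \<sigma> u) (\<pi> i) = \<sigma> i (coord u i)"
    using u unfolding wreath_def by auto
qed

lemma wreath_diff:
  assumes \<pi>: "\<pi> permutes {..<d}" and \<sigma>: "\<forall>i<d. \<sigma> i permutes {1..m}" and uv: "u \<in> V" "v \<in> V"
  shows "diff (wreath \<pi> \<sigma> u) (wreath \<pi> \<sigma> v) = \<pi> ` diff u v"
proof -
  have "\<pi> i \<in> diff (wreath \<pi> \<sigma> u) (wreath \<pi> \<sigma> v) \<longleftrightarrow> i \<in> diff u v" if "i < d" for i
    using that permutes_in_image[OF \<pi>, of i] permutes_inj[OF \<sigma>[rule_format, OF that]]
    by (simp add: diff_def wreath_coord[OF \<pi> \<sigma> uv(1)] wreath_coord[OF \<pi> \<sigma> uv(2)] inj_eq)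
  then have "\<pi> i \<in> diff (wreath \<pi> \<sigma> u) (wreath \<pi> \<sigma> v) \<longleftrightarrow> \<pi> i \<in> \<pi> ` diff u v" if "i < d" for i
    using that by (simp add: inj_image_mem_iff[OF permutes_inj[OF \<pi>]])
  moreover have "\<exists>i<d. j = \<pi> i" if "j < d" for j
    using permutes_image[OF \<pi>] that by (metis imageE lessThan_iff)
  ultimately have "j \<in> diff (wreath \<pi> \<sigma> u) (wreath \<pi> \<sigma> v) \<longleftrightarrow> j \<in> \<pi> ` diff u v"
    if "j \<in> {..<d}" for j
    using that by (metis lessThan_iff)
  moreover have "\<pi> ` diff u v \<subseteq> {..<d}"
    using image_mono[OF diff_subset, of \<pi> u v] permutes_image[OF \<pi>] by simp
  ultimately show ?thesis
    using diff_subset[of "wreath \<pi> \<sigma> u" "wreath \<pi> \<sigma> v"] by blast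
qed

lemma wreath_permutes:
  assumes \<pi>: "\<pi> permutes {..<d}" and \<sigma>: "\<forall>i<d. \<sigma> i permutes {1..m}"
  shows "wreath \<pi> \<sigma> permutes V"
proof (rule bij_imp_permutes)
  have inj: "inj_on (wreath \<pi> \<sigma>) V"
  proof (rule inj_onI)
    fix u v assume "u \<in> V" "v \<in> V" "wreath \<pi> \<sigma> u = wreath \<pi> \<sigma> v"
    then show "u = v" using wreath_diff[OF \<pi> \<sigma>, of u v] diff_empty_iff[of u v] by simp
  qed
  moreover have "wreath \<pi> \<sigma> ` V = V"
    using wreath_in[OF \<pi> \<sigma>] by (intro endo_inj_surj[OF finite_V _ inj]) auto
  ultimately show "bij_betw (wreath \<pi> \<sigma>) V V" by (simp add: bij_betw_def)
qed (simp add: wreath_def)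

lemma obtain_coord:
  assumes "i < d" "x \<in> {1..m}"
  obtains u where "u \<in> V" "coord u i = x"
  using coord_ex[of "\<lambda>_. x"] assms by blast

text \<open>As \<open>g\<close> maps differences by \<open>\<pi>\<close>, the letter of \<open>g u\<close> at \<open>\<pi> i\<close> depends only on the letter of \<open>u\<close>
  at \<open>i\<close>; this dependence is \<open>\<sigma> i\<close>.\<close>

lemma wreath_exhaust:
  assumes \<pi>: "\<pi> permutes {..<d}" and g: "g permutes V"
    and gd: "\<And>u v. u \<in> V \<Longrightarrow> v \<in> V \<Longrightarrow> diff (g u) (g v) = \<pi> ` diff u v"
  obtains \<sigma> where "\<sigma> \<in> {..<d} \<rightarrow>\<^sub>E {s. s permutes {1..m}}" "g = wreath \<pi> \<sigma>"
proof -
  have gV: "g u \<in> V" if "u \<in> V" for u using that permutes_in_image[OF g] by simp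
  \<comment> \<open>\<open>U i x\<close> is an arbitrary word with letter \<open>x\<close> at position \<open>i\<close>.\<close>
  define U where "U i x = (SOME u. u \<in> V \<and> coord u i = x)" for i x
  have U: "U i x \<in> V" "coord (U i x) i = x" if "i < d" "x \<in> {1..m}" for i x
    using someI_ex[of "\<lambda>u. u \<in> V \<and> coord u i = x"] obtain_coord[OF that] unfolding U_def by metis+
  define \<sigma> where "\<sigma> = (\<lambda>i\<in>{..<d}. \<lambda>x. if x \<in> {1..m} then coord (g (U i x)) (\<pi> i) else x)"
  have \<pi>d: "\<pi> i < d" if "i < d" for i using permutes_in_image[OF \<pi>, of i] that by simp
  have iff: "coord (g u) (\<pi> i) = coord (g v) (\<pi> i) \<longleftrightarrow> coord u i = coord v i"
    if "u \<in> V" "v \<in> V" "i < d" for u v i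
  proof -
    have "\<pi> i \<in> diff (g u) (g v) \<longleftrightarrow> i \<in> diff u v"
      unfolding gd[OF that(1,2)] by (rule inj_image_mem_iff[OF permutes_inj[OF \<pi>]])
    then show ?thesis using that(3) \<pi>d[OF that(3)] by (simp add: diff_def)
  qed
  have perm: "\<forall>i<d. \<sigma> i permutes {1..m}"
  proof (intro allI impI bij_imp_permutes)
    fix i assume i: "i < d"
    have inj: "inj_on (\<sigma> i) {1..m}"
      by (rule inj_onI) (use iff U i in \<open>simp add: \<sigma>_def\<close>)
    moreover have "\<sigma> i ` {1..m} \<subseteq> {1..m}"
      using coord_in[OF gV[OF U(1)]] \<pi>d i by (auto simp: \<sigma>_def)
    ultimately show "bij_betw (\<sigma> i) {1..m} {1..m}"
      using endo_inj_surj[OF _ _ inj] by (simp add: bij_betw_def)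
  qed (auto simp: \<sigma>_def)
  have \<sigma>: "\<sigma> \<in> {..<d} \<rightarrow>\<^sub>E {s. s permutes {1..m}}"
    using perm by (auto simp: \<sigma>_def PiE_iff)
  moreover have "g u = wreath \<pi> \<sigma> u" for u
  proof (cases "u \<in> V")
    case True
    have "coord (g u) (\<pi> i) = coord (wreath \<pi> \<sigma> u) (\<pi> i)" if i: "i < d" for i
    proof -
      have "coord u i \<in> {1..m}" by (rule coord_in[OF True i])
      then have "coord (g u) (\<pi> i) = \<sigma> i (coord u i)"
        using iff[OF True U(1)[OF i] i, of "coord u i"] U(2)[OF i] i by (simp add: \<sigma>_def)
      then show ?thesis using wreath_coord[OF \<pi> perm True i] by simp
    qed
    moreover have "\<exists>i<d. j = \<pi> i" if "j < d" for j
      using permutes_image[OF \<pi>] that by (metis imageE lessThan_iff)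
    ultimately show ?thesis
      using coord_eqI[OF gV[OF True] wreath_in[OF \<pi> perm True]] by blast
  next
    case False
    then show ?thesis using permutes_not_in[OF g] by (simp add: wreath_def)
  qed
  ultimately show thesis using that by blast
qed

lemma inj_on_wreath:
  "inj_on (\<lambda>(\<pi>, \<sigma>). wreath \<pi> \<sigma>) ({\<pi>. \<pi> permutes {..<d}} \<times> ({..<d} \<rightarrow>\<^sub>E {s. s permutes {1..m}}))"
proof (rule inj_onI, clarify)
  fix \<pi> \<pi>' :: "nat \<Rightarrow> nat" and \<sigma> \<sigma>' :: "nat \<Rightarrow> nat \<Rightarrow> nat"
  assume \<pi>: "\<pi> permutes {..<d}" "\<pi>' permutes {..<d}"
    and \<sigma>E: "\<sigma> \<in> {..<d} \<rightarrow>\<^sub>E {s. s permutes {1..m}}" "\<sigma>' \<in> {..<d} \<rightarrow>\<^sub>E {s. s permutes {1..m}}"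
    and eq: "wreath \<pi> \<sigma> = wreath \<pi>' \<sigma>'"
  have \<sigma>: "\<forall>i<d. \<sigma> i permutes {1..m}" "\<forall>i<d. \<sigma>' i permutes {1..m}"
    using \<sigma>E by (auto simp: PiE_iff)
  obtain u0 where u0: "u0 \<in> V" using V_nonempty by blast
  have "\<pi> i = \<pi>' i" for i
  proof (cases "i < d")
    case True
    obtain v where v: "v \<in> V" "diff u0 v = {i}" using diff_realised[OF u0, of "{i}"] True by auto
    show ?thesis
      using wreath_diff[OF \<pi>(1) \<sigma>(1) u0 v(1)] wreath_diff[OF \<pi>(2) \<sigma>(2) u0 v(1)] v(2) eq by simp
  next
    case False
    then show ?thesis using permutes_not_in[OF \<pi>(1), of i] permutes_not_in[OF \<pi>(2), of i] by simp
  qed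
  then have \<pi>eq: "\<pi> = \<pi>'" by blast
  have "\<sigma> i = \<sigma>' i" if i: "i < d" for i
  proof
    fix x show "\<sigma> i x = \<sigma>' i x"
    proof (cases "x \<in> {1..m}")
      case True
      obtain u where u: "u \<in> V" "coord u i = x" using obtain_coord[OF i True] .
      show ?thesis
        using wreath_coord[OF \<pi>(1) \<sigma>(1) u(1) i] wreath_coord[OF \<pi>(2) \<sigma>(2) u(1) i] u(2) eq \<pi>eq by simp
    next
      case False
      then show ?thesis using permutes_not_in[OF \<sigma>(1)[rule_format, OF i]] permutes_not_in[OF \<sigma>(2)[rule_format, OF i]] by metis
    qed
  qed
  then have "\<sigma> = \<sigma>'" by (intro PiE_ext[OF \<sigma>E]) auto
  then show "\<pi> = \<pi>' \<and> \<sigma> = \<sigma>'" using \<pi>eq by simp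
qed

end

context hamming_sandwich
begin

abbreviation "G \<equiv> Aut V sandwich"

definition stab :: "(nat \<Rightarrow> nat) set" where
  "stab = {\<pi>. \<pi> permutes {..<d} \<and> (\<forall>A\<subseteq>{..<d}. ty (\<pi> ` A) = ty A)}"

lemma Aut_preserves_type:
  assumes "g \<in> carrier G" "u \<in> V" "v \<in> V"
  shows "ty (diff (g u) (g v)) = ty (diff u v)"
proof -
  have "map_prod g g (u, v) \<in> map_prod g g ` rel_of (ty (diff u v))"
    using in_rel_of_diff[OF assms(2,3)] by (rule imageI)
  also have "\<dots> = rel_of (ty (diff u v))"
    using assms(1) rel_of_in_sandwich[OF diff_subset] by (simp add: Aut_def)
  finally show ?thesis by (simp add: rel_of_def)
qed

lemma Aut_permutes: "g \<in> carrier G \<Longrightarrow> g permutes V"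
  by (simp add: Aut_def)

lemma Aut_direction:
  assumes g: "g \<in> carrier G"
  obtains \<pi> where "\<pi> \<in> stab" "\<And>u v. u \<in> V \<Longrightarrow> v \<in> V \<Longrightarrow> diff (g u) (g v) = \<pi> ` diff u v"
proof -
  have "card (diff (g u) (g v)) = card (diff u v)" if "u \<in> V" "v \<in> V" for u v
    using ty_card[OF diff_subset diff_subset Aut_preserves_type[OF g that]] .
  then obtain \<pi> where \<pi>: "\<pi> permutes {..<d}" "\<forall>u\<in>V. \<forall>v\<in>V. diff (g u) (g v) = \<pi> ` diff u v"
    using isometry_direction[OF Aut_permutes[OF g]] by blast
  obtain u where u: "u \<in> V" using V_nonempty by blast
  have "ty (\<pi> ` A) = ty A" if A: "A \<subseteq> {..<d}" for A
  proof -
    obtain v where "v \<in> V" "diff u v = A" using diff_realised[OF u A] .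
    then show ?thesis using \<pi>(2) Aut_preserves_type[OF g u] u by metis
  qed
  with \<pi>(1) have "\<pi> \<in> stab" by (simp add: stab_def)
  then show thesis using \<pi>(2) by (intro that) auto
qed

lemma Aut_intro:
  assumes g: "g permutes V" and \<pi>: "\<pi> \<in> stab"
    and gd: "\<And>u v. u \<in> V \<Longrightarrow> v \<in> V \<Longrightarrow> diff (g u) (g v) = \<pi> ` diff u v"
  shows "g \<in> carrier G"
proof -
  have "map_prod g g ` R = R" if R: "R \<in> sandwich" for R
  proof (rule card_subset_eq)
    obtain t where t: "R = rel_of t" using R unfolding sandwich_def by blast
    have RV: "R \<subseteq> V \<times> V" unfolding t rel_of_def by auto
    show "finite R" by (rule finite_subset[OF RV]) (simp add: finite_V)
    show "map_prod g g ` R \<subseteq> R"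
      using \<pi> gd permutes_in_image[OF g] diff_subset unfolding t rel_of_def stab_def by auto
    show "card (map_prod g g ` R) = card R"
      using prod.inj_map[OF permutes_inj[OF g] permutes_inj[OF g]] by (intro card_image) (rule inj_on_subset, auto)
  qed
  then show ?thesis using g by (simp add: Aut_def)
qed

lemma stab_permutes: "\<pi> \<in> stab \<Longrightarrow> \<pi> permutes {..<d}"
  by (simp add: stab_def)

text \<open>The automorphism group is the product-action wreath product of \<open>Sym(m)\<close> with the stabiliser of
  the typing.\<close>

lemma carrier_Aut: "carrier G = (\<lambda>(\<pi>, \<sigma>). wreath \<pi> \<sigma>) ` (stab \<times> ({..<d} \<rightarrow>\<^sub>E {s. s permutes {1..m}}))"
proof (intro equalityI subsetI)
  fix g assume g: "g \<in> carrier G"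
  obtain \<pi> where \<pi>: "\<pi> \<in> stab" "\<And>u v. u \<in> V \<Longrightarrow> v \<in> V \<Longrightarrow> diff (g u) (g v) = \<pi> ` diff u v"
    using Aut_direction[OF g] by blast
  obtain \<sigma> where "\<sigma> \<in> {..<d} \<rightarrow>\<^sub>E {s. s permutes {1..m}}" "g = wreath \<pi> \<sigma>"
    using wreath_exhaust[OF stab_permutes[OF \<pi>(1)] Aut_permutes[OF g] \<pi>(2)] by blast
  with \<pi>(1) show "g \<in> (\<lambda>(\<pi>, \<sigma>). wreath \<pi> \<sigma>) ` (stab \<times> ({..<d} \<rightarrow>\<^sub>E {s. s permutes {1..m}}))" by auto
next
  fix g assume "g \<in> (\<lambda>(\<pi>, \<sigma>). wreath \<pi> \<sigma>) ` (stab \<times> ({..<d} \<rightarrow>\<^sub>E {s. s permutes {1..m}}))"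
  then obtain \<pi> \<sigma> where *: "\<pi> \<in> stab" "g = wreath \<pi> \<sigma>" "\<forall>i<d. \<sigma> i permutes {1..m}"
    by (auto simp: PiE_iff)
  show "g \<in> carrier G" unfolding *(2)
    by (rule Aut_intro[OF wreath_permutes *(1) wreath_diff]) (use * stab_permutes in auto)
qed

lemma order_Aut: "order G = card stab * fact m ^ d"
proof -
  have "order G = card (stab \<times> ({..<d} \<rightarrow>\<^sub>E {s. s permutes {1..m}}))"
    unfolding order_def carrier_Aut
    by (rule card_image[OF inj_on_subset[OF inj_on_wreath]]) (use stab_permutes in auto)
  moreover have "card {s. s permutes {1..m}} = fact m" by (rule card_permutations) auto
  ultimately show ?thesis by (simp add: card_cartesian_product card_PiE)
qed

lemma id_in_stab: "id \<in> stab"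
  by (simp add: stab_def permutes_id)

lemma wreath_in_Aut:
  "\<pi> \<in> stab \<Longrightarrow> \<forall>i<d. \<sigma> i permutes {1..m} \<Longrightarrow> wreath \<pi> \<sigma> \<in> carrier G"
  using stab_permutes by (intro Aut_intro[OF wreath_permutes _ wreath_diff]) auto

lemma transitive_Aut: "transitive_on V G"
  unfolding transitive_on_def
proof (intro ballI)
  fix u v assume uv: "u \<in> V" "v \<in> V"
  define \<sigma> where "\<sigma> i = transpose (coord u i) (coord v i)" for i
  have \<sigma>: "\<forall>i<d. \<sigma> i permutes {1..m}"
    unfolding \<sigma>_def using coord_in uv by (intro allI impI permutes_swap_id)
  have "wreath id \<sigma> u = v"
  proof (rule coord_eqI[OF wreath_in[OF permutes_id \<sigma> uv(1)] uv(2)])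
    fix i assume "i < d"
    then have "coord (wreath id \<sigma> u) (id i) = \<sigma> i (coord u i)"
      by (rule wreath_coord[OF permutes_id \<sigma> uv(1)])
    also have "\<dots> = coord v i" by (simp add: \<sigma>_def)
    finally show "coord (wreath id \<sigma> u) i = coord v i" by simp
  qed
  then show "\<exists>g\<in>carrier G. g u = v" using wreath_in_Aut[OF id_in_stab \<sigma>] by blast
qed

text \<open>The blocks consist of the words that agree outside \<open>J\<close>.\<close>

lemma imprimitive_Aut:
  assumes J: "J \<subseteq> {..<d}" "J \<noteq> {}" "J \<noteq> {..<d}" and inv: "\<And>\<pi>. \<pi> \<in> stab \<Longrightarrow> \<pi> ` J = J"
  shows "imprimitive_on V G"
proof -
  define block where "block u = {w \<in> V. diff u w \<subseteq> J}" for u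
  have self: "u \<in> block u" if "u \<in> V" for u using that unfolding block_def by simp
  have block_eq: "block w = block u" if "w \<in> block u" for u w
    using that diff_triangle diff_commute unfolding block_def by (smt (verit) Collect_cong Un_subset_iff mem_Collect_eq subset_trans)
  have "partition_on V (block ` V)"
  proof (rule partition_onI)
    show "\<Union>(block ` V) = V" using self unfolding block_def by blast
    show "{} \<notin> block ` V" using self by auto
    show "disjnt p q" if "p \<in> block ` V" "q \<in> block ` V" "p \<noteq> q" for p q
      using that block_eq unfolding disjnt_def by blast
  qed
  moreover have "block ` V \<noteq> {V}"
  proof
    assume *: "block ` V = {V}"
    obtain i where i: "i < d" "i \<notin> J" using J by auto
    obtain u where u: "u \<in> V" using V_nonempty by blast
    obtain v where v: "v \<in> V" "diff u v = {i}" using diff_realised[OF u, of "{i}"] i by auto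
    have "v \<in> block u" using * u v by blast
    then show False using v(2) i(2) unfolding block_def by simp
  qed
  moreover have "block ` V \<noteq> (\<lambda>v. {v}) ` V"
  proof
    assume *: "block ` V = (\<lambda>v. {v}) ` V"
    obtain i where i: "i < d" "i \<in> J" using J by auto
    obtain u where u: "u \<in> V" using V_nonempty by blast
    obtain v where v: "v \<in> V" "diff u v = {i}" using diff_realised[OF u, of "{i}"] i by auto
    have "v \<in> block u" "u \<in> block u" using i(2) u v unfolding block_def by auto
    moreover obtain w where "block u = {w}" using * u by (metis imageE image_eqI)
    ultimately have "u = v" by simp
    then show False using v(2) by simp
  qed
  moreover have "g ` block u \<in> block ` V" if g: "g \<in> carrier G" and u: "u \<in> V" for g u
  proof -
    obtain \<pi> where \<pi>: "\<pi> \<in> stab" "\<And>u v. u \<in> V \<Longrightarrow> v \<in> V \<Longrightarrow> diff (g u) (g v) = \<pi> ` diff u v"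
      using Aut_direction[OF g] by blast
    have gV: "g ` V = V" using permutes_image[OF Aut_permutes[OF g]] .
    have iff: "g w \<in> block (g u) \<longleftrightarrow> w \<in> block u" if w: "w \<in> V" for w
    proof -
      have "\<pi> ` diff u w \<subseteq> \<pi> ` J \<longleftrightarrow> diff u w \<subseteq> J"
        by (rule inj_image_subset_iff[OF permutes_inj[OF stab_permutes[OF \<pi>(1)]]])
      then show ?thesis using \<pi>(2)[OF u w] inv[OF \<pi>(1)] gV w unfolding block_def by auto
    qed
    have "g ` block u = block (g u)"
    proof (intro equalityI subsetI)
      fix y assume "y \<in> g ` block u" then show "y \<in> block (g u)"
        using iff unfolding block_def by blast
    next
      fix y assume y: "y \<in> block (g u)"
      then have "y \<in> V" unfolding block_def by simp
      then obtain w where "w \<in> V" "y = g w" using gV by blast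
      then show "y \<in> g ` block u" using iff y by blast
    qed
    then show ?thesis using gV u by blast
  qed
  ultimately show ?thesis unfolding imprimitive_on_def
    by (intro conjI transitive_Aut exI[of _ "block ` V"]) auto
qed

lemma prod_one_exception:
  fixes a b :: nat
  assumes "i < d"
  shows "(\<Prod>j\<in>{..<d}. if j = i then a else b) = a * b ^ (d - 1)"
proof -
  have "(\<Prod>j\<in>{..<d}. if j = i then a else b) = a * (\<Prod>j\<in>{..<d} - {i}. if j = i then a else b)"
    using assms by (subst prod.remove[of _ i]) auto
  also have "(\<Prod>j\<in>{..<d} - {i}. if j = i then a else b) = (\<Prod>j\<in>{..<d} - {i}. b)"
    by (intro prod.cong) auto
  finally show ?thesis using assms by simp
qed

text \<open>If \<open>\<pi>\<close> moves \<open>i\<close>, the letter of a fixed word at \<open>\<pi> i\<close> is determined by its other letters, which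
  leaves at most \<open>m ^ (d - 1)\<close> fixed words among \<open>m ^ d \<ge> 3 * m ^ (d - 1)\<close>. Otherwise some \<open>\<sigma> i\<close>
  moves two letters, and all words with one of them at position \<open>i\<close> are moved.\<close>

lemma moved_ge:
  assumes g: "g \<in> carrier G" "g \<noteq> id"
  shows "2 * m ^ (d - 1) \<le> card {v \<in> V. g v \<noteq> v}"
proof -
  obtain \<pi> \<sigma> where p: "\<pi> \<in> stab" "g = wreath \<pi> \<sigma>" "\<forall>i<d. \<sigma> i permutes {1..m}"
    using g(1) unfolding carrier_Aut by (auto simp: PiE_iff)
  note \<pi> = stab_permutes[OF p(1)]
  note gd = wreath_diff[OF \<pi> p(3), folded p(2)]
  show ?thesis
  proof (cases "\<pi> = id")
    case False
    then obtain i where i: "\<pi> i \<noteq> i" by (auto simp: fun_eq_iff)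
    then have id: "i < d" using permutes_not_in[OF \<pi>, of i] by auto
    have pd: "\<pi> i < d" using permutes_in_image[OF \<pi>, of i] id by simp
    let ?F = "{v \<in> V. g v = v}"
    \<comment> \<open>Two fixed words cannot differ exactly at \<open>\<pi> i\<close>, since then their images differ at \<open>\<pi> (\<pi> i)\<close>
      and not at \<open>\<pi> i\<close>.\<close>
    have "inj_on (\<lambda>v. restrict (coord v) ({..<d} - {\<pi> i})) ?F"
    proof (rule inj_onI)
      fix u v assume u: "u \<in> ?F" and v: "v \<in> ?F"
        and eq: "restrict (coord u) ({..<d} - {\<pi> i}) = restrict (coord v) ({..<d} - {\<pi> i})"
      have "coord u j = coord v j" if "j < d" "j \<noteq> \<pi> i" for j
        using fun_cong[OF eq, of j] that by simp
      then have sub: "diff u v \<subseteq> {\<pi> i}" unfolding diff_def by auto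
      have "diff u v = \<pi> ` diff u v" using gd[of u v] u v by auto
      moreover have "\<pi> i \<notin> \<pi> ` diff u v"
      proof
        assume "\<pi> i \<in> \<pi> ` diff u v"
        then have "i \<in> diff u v" using inj_image_mem_iff[OF permutes_inj[OF \<pi>]] by simp
        then show False using sub i by auto
      qed
      ultimately have "diff u v = {}" using sub by blast
      then show "u = v" using diff_empty_iff u v by auto
    qed
    moreover have "(\<lambda>v. restrict (coord v) ({..<d} - {\<pi> i})) ` ?F \<subseteq> ({..<d} - {\<pi> i}) \<rightarrow>\<^sub>E {1..m}"
      using coord_in by (auto split: if_splits)
    ultimately have "card ?F \<le> card (({..<d} - {\<pi> i}) \<rightarrow>\<^sub>E {1..m})"
      by (intro card_inj_on_le) (auto intro: finite_PiE)
    also have "\<dots> = m ^ (d - 1)" using pd by (simp add: card_PiE)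
    finally have F: "card ?F \<le> m ^ (d - 1)" .
    have "{v \<in> V. g v \<noteq> v} = V - ?F" by auto
    then have "card {v \<in> V. g v \<noteq> v} = m ^ d - card ?F"
      using finite_V by (simp add: card_Diff_subset card_V)
    moreover have "m ^ d = m * m ^ (d - 1)" using id by (cases d) auto
    moreover have "3 * m ^ (d - 1) \<le> m * m ^ (d - 1)" using m3 by (rule mult_le_mono1)
    ultimately show ?thesis using F by linarith
  next
    case True
    have co: "coord (g u) i = \<sigma> i (coord u i)" if "u \<in> V" "i < d" for u i
      using wreath_coord[OF \<pi> p(3) that] True p(2) by simp
    have "\<exists>i<d. \<sigma> i \<noteq> id"
    proof (rule ccontr)
      assume "\<not> ?thesis"
      then have "g u = u" for u
      proof (cases "u \<in> V")
        case True
        then show ?thesis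
          using co[OF True] \<open>\<not> (\<exists>i<d. \<sigma> i \<noteq> id)\<close> permutes_in_image[OF Aut_permutes[OF g(1)], of u]
          by (intro coord_eqI) auto
      qed (simp add: p(2) wreath_def)
      then show False using g(2) by auto
    qed
    then obtain i x where i: "i < d" and x: "\<sigma> i x \<noteq> x" by (auto simp: fun_eq_iff)
    define S where "S j = (if j = i then {x, \<sigma> i x} else {1..m})" for j
    have xm: "x \<in> {1..m}" using permutes_not_in[OF p(3)[rule_format, OF i]] x by metis
    have sm: "\<sigma> i x \<in> {1..m}" using permutes_in_image[OF p(3)[rule_format, OF i]] xm by blast
    have ssx: "\<sigma> i (\<sigma> i x) \<noteq> \<sigma> i x" using x permutes_inj[OF p(3)[rule_format, OF i]] by (simp add: inj_eq)
    have "card {v \<in> V. \<forall>j<d. coord v j \<in> S j} = (\<Prod>j<d. card (S j))"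
      by (rule card_box) (use xm sm in \<open>auto simp: S_def\<close>)
    also have "\<dots> = (\<Prod>j\<in>{..<d}. if j = i then 2 else m)"
      using x by (intro prod.cong) (auto simp: S_def)
    also have "\<dots> = 2 * m ^ (d - 1)"
      by (rule prod_one_exception[OF i])
    finally have "card {v \<in> V. \<forall>j<d. coord v j \<in> S j} = 2 * m ^ (d - 1)" .
    moreover have "{v \<in> V. \<forall>j<d. coord v j \<in> S j} \<subseteq> {v \<in> V. g v \<noteq> v}"
    proof clarify
      fix v assume v: "v \<in> V" "\<forall>j<d. coord v j \<in> S j" "g v = v"
      have "coord v i \<in> {x, \<sigma> i x}" using v(2) i unfolding S_def by (auto split: if_splits)
      then show False using co[OF v(1) i] v(3) x ssx by auto
    qed
    then have "card {v \<in> V. \<forall>j<d. coord v j \<in> S j} \<le> card {v \<in> V. g v \<noteq> v}"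
      by (rule card_mono[rotated]) (simp add: finite_V)
    ultimately show ?thesis by simp
  qed
qed

text \<open>The bound is attained by a transposition of two letters at one position.\<close>

lemma minimal_degree_Aut:
  assumes "d > 0"
  shows "minimal_degree V G = 2 * m ^ (d - 1)"
proof -
  define \<sigma> where "\<sigma> i = (if i = 0 then transpose 1 (2::nat) else id)" for i :: nat
  have \<sigma>: "\<forall>i<d. \<sigma> i permutes {1..m}"
    unfolding \<sigma>_def using m3 by (auto simp: permutes_id intro!: permutes_swap_id)
  let ?g = "wreath id \<sigma>"
  have g: "?g \<in> carrier G" by (rule wreath_in_Aut[OF id_in_stab \<sigma>])
  have co: "coord (?g u) i = \<sigma> i (coord u i)" if "u \<in> V" "i < d" for u i
    using wreath_coord[OF permutes_id \<sigma> that] by simp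
  define S where "S j = (if j = 0 then {1, 2} else {1..m})" for j :: nat
  have "{v \<in> V. ?g v \<noteq> v} \<subseteq> {v \<in> V. \<forall>j<d. coord v j \<in> S j}"
  proof clarify
    fix v j assume v: "v \<in> V" "?g v \<noteq> v" and j: "j < d"
    show "coord v j \<in> S j"
    proof (rule ccontr)
      assume "coord v j \<notin> S j"
      then have "j = 0" "coord v 0 \<noteq> 1" "coord v 0 \<noteq> 2"
        using coord_in[OF v(1) j] by (auto simp: S_def split: if_splits)
      then have "\<sigma> i (coord v i) = coord v i" for i by (auto simp: \<sigma>_def)
      then have "?g v = v"
        using co[OF v(1)] wreath_in[OF permutes_id \<sigma> v(1)] v(1) by (intro coord_eqI) auto
      then show False using v(2) by simp
    qed
  qed
  then have "card {v \<in> V. ?g v \<noteq> v} \<le> card {v \<in> V. \<forall>j<d. coord v j \<in> S j}"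
    using finite_V by (intro card_mono) auto
  also have "\<dots> = (\<Prod>j<d. card (S j))"
    by (rule card_box) (use m3 in \<open>auto simp: S_def\<close>)
  also have "\<dots> = (\<Prod>j\<in>{..<d}. if j = 0 then 2 else m)"
    by (intro prod.cong) (auto simp: S_def)
  also have "\<dots> = 2 * m ^ (d - 1)"
    by (rule prod_one_exception[OF assms])
  finally have le: "card {v \<in> V. ?g v \<noteq> v} \<le> 2 * m ^ (d - 1)" .
  have "?g \<noteq> id"
  proof
    assume *: "?g = id"
    obtain u where u: "u \<in> V" "coord u 0 = 1" using obtain_coord[OF assms, of 1] m3 by auto
    then show False using co[OF u(1) assms] * by (simp add: \<sigma>_def)
  qed
  then have "card {v \<in> V. ?g v \<noteq> v} = 2 * m ^ (d - 1)" using moved_ge[OF g] le by simp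
  moreover have one: "\<one>\<^bsub>G\<^esub> = id" by (simp add: Aut_def)
  ultimately show ?thesis unfolding minimal_degree_def
    using g \<open>?g \<noteq> id\<close> moved_ge by (intro Least_equality) (auto simp: one)
qed

end

section \<open>Alternating groups and their sections\<close>

text \<open>The group \<open>Alt(t)\<close> is \<open>(t - 2)\<close>-transitive: two points outside the image are free to correct the
  parity.\<close>

lemma alt_group_extends_injection:
  assumes S: "S \<subseteq> {1..t}" "card S + 2 \<le> t" and f: "inj_on f S" "f ` S \<subseteq> {1..t}"
  obtains g where "g \<in> carrier (alt_group t)" "\<And>x. x \<in> S \<Longrightarrow> g x = f x"
proof -
  have finS: "finite S" using S(1) finite_subset by blast
  have cf: "card (f ` S) = card S" by (rule card_image[OF f(1)])
  have "card ({1..t} - S) = card ({1..t} - f ` S)"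
    using S(1) f(2) finS cf by (simp add: card_Diff_subset)
  then obtain h where h: "bij_betw h ({1..t} - S) ({1..t} - f ` S)"
    using finite_same_card_bij[of "{1..t} - S" "{1..t} - f ` S"] by auto
  define p where "p x = (if x \<in> S then f x else if x \<in> {1..t} then h x else x)" for x
  have "bij_betw p (S \<union> ({1..t} - S)) (f ` S \<union> ({1..t} - f ` S))"
  proof (rule bij_betw_combine)
    show "bij_betw p S (f ` S)" using f(1) by (simp add: bij_betw_def inj_on_def p_def)
    have "bij_betw p ({1..t} - S) ({1..t} - f ` S) \<longleftrightarrow> bij_betw h ({1..t} - S) ({1..t} - f ` S)"
      by (rule bij_betw_cong) (simp add: p_def)
    then show "bij_betw p ({1..t} - S) ({1..t} - f ` S)" using h by simp
  qed auto
  moreover have "S \<union> ({1..t} - S) = {1..t}" "f ` S \<union> ({1..t} - f ` S) = {1..t}" using S(1) f(2) by auto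
  ultimately have p: "p permutes {1..t}"
    using S(1) by (intro bij_imp_permutes) (auto simp: p_def)
  have "2 \<le> card ({1..t} - f ` S)"
    using f(2) finS cf S(2) by (simp add: card_Diff_subset)
  then obtain B where B: "B \<subseteq> {1..t} - f ` S" "card B = 2" by (meson obtain_subset_with_card_n)
  then obtain a b where ab: "a \<noteq> b" "a \<in> {1..t} - f ` S" "b \<in> {1..t} - f ` S"
    by (auto simp: card_2_iff)
  have pp: "permutation p" using p permutation_permutes by blast
  show thesis
  proof (cases "evenperm p")
    case True
    then show thesis using p by (intro that[of p]) (auto simp: alt_group_carrier p_def)
  next
    case False
    let ?g = "transpose a b \<circ> p"
    have "?g permutes {1..t}" using ab by (intro permutes_compose[OF p] permutes_swap_id) auto
    moreover have "evenperm ?g"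
      using False ab(1) by (simp add: evenperm_comp[OF permutation_swap_id pp] evenperm_swap)
    moreover have "?g x = f x" if "x \<in> S" for x
      using that ab by (auto simp: p_def transpose_def)
    ultimately show thesis by (intro that[of ?g]) (auto simp: alt_group_carrier)
  qed
qed

text \<open>This is all of the simplicity of \<open>Alt(t)\<close> that is used below: two nontrivial normal subgroups
  do not centralise each other. Fix \<open>a\<close> with \<open>\<sigma> a \<noteq> a\<close>. By multiple transitivity the conjugate \<open>\<tau>'\<close>
  of \<open>\<tau>\<close> can be prescribed at \<open>a\<close> and \<open>\<sigma> a\<close> in such a way that \<open>\<sigma> (\<tau>' a) \<noteq> \<tau>' (\<sigma> a)\<close>. How many
  points have to be prescribed depends on the cycles of \<open>\<tau>\<close>: three if \<open>\<tau>\<close> is not an involution or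
  has a fixed point, and four otherwise, in which case \<open>t\<close> is even and hence at least \<open>6\<close>.\<close>

lemma alt_group_noncommuting_conjugate:
  assumes t: "t \<ge> 5" and \<sigma>: "\<sigma> \<in> carrier (alt_group t)" "\<sigma> \<noteq> id" and \<tau>: "\<tau> \<in> carrier (alt_group t)" "\<tau> \<noteq> id"
  obtains g where "g \<in> carrier (alt_group t)"
    "\<sigma> \<circ> (g \<circ> \<tau> \<circ> inv' g) \<noteq> (g \<circ> \<tau> \<circ> inv' g) \<circ> \<sigma>"
proof -
  note witness = that
  have p\<sigma>: "\<sigma> permutes {1..t}" and p\<tau>: "\<tau> permutes {1..t}"
    using \<sigma>(1) \<tau>(1) by (auto simp: alt_group_carrier)
  note inj = permutes_inj[OF p\<sigma>] permutes_inj[OF p\<tau>]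
  obtain a where a: "\<sigma> a \<noteq> a" using \<sigma>(2) by (auto simp: fun_eq_iff)
  have at: "a \<in> {1..t}" "\<sigma> a \<in> {1..t}"
    using permutes_not_in[OF p\<sigma>, of a] permutes_in_image[OF p\<sigma>, of a] a by blast+
  have pick: "\<exists>x. x \<in> {1..t} \<and> x \<notin> F" if "card F \<le> 4" "finite F" for F
  proof -
    have "\<not> {1..t} \<subseteq> F" using card_mono[OF that(2), of "{1..t}"] that(1) t by auto
    then show ?thesis by blast
  qed
  have c4: "card {w, x, y, z} \<le> 4" for w x y z :: nat by (simp add: card_insert_if)
  have ext: "\<exists>g\<in>carrier (alt_group t). map g xs = ys"
    if xy: "distinct xs" "distinct ys" "length xs = length ys" "length xs + 2 \<le> t" "set xs \<subseteq> {1..t}" "set ys \<subseteq> {1..t}"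
    for xs ys :: "nat list"
  proof -
    let ?f = "\<lambda>x. the (map_of (zip xs ys) x)"
    have f: "map ?f xs = ys"
      using xy(1,3) by (intro nth_equalityI) (simp_all add: map_of_zip_nth)
    have "inj_on ?f (set xs)" using xy(2) f distinct_map by metis
    moreover have "?f ` set xs \<subseteq> {1..t}" using f xy(6) by (metis image_set)
    moreover have "card (set xs) + 2 \<le> t" using xy(1,4) by (simp add: distinct_card)
    ultimately obtain g where "g \<in> carrier (alt_group t)" "\<And>x. x \<in> set xs \<Longrightarrow> g x = ?f x"
      using alt_group_extends_injection[OF xy(5), of ?f] by blast
    then show ?thesis using f by (intro bexI[of _ g]) (metis map_cong)
  qed
  \<comment> \<open>The conjugate by \<open>g\<close> sends \<open>a\<close> to \<open>g (\<tau> x)\<close> and \<open>\<sigma> a\<close> to \<open>g (\<tau> y)\<close>. In each case below \<open>g\<close> is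
    chosen so that \<open>\<sigma>\<close> does not send the first image to the second.\<close>
  have finish: thesis
    if g: "g \<in> carrier (alt_group t)" and v: "g x = a" "g y = \<sigma> a" and ne: "\<sigma> (g (\<tau> x)) \<noteq> g (\<tau> y)" for g x y
  proof (rule witness[OF g])
    have pg: "g permutes {1..t}" using g by (simp add: alt_group_carrier)
    have i: "inv' g a = x" "inv' g (\<sigma> a) = y" using v permutes_inverses(2)[OF pg] by metis+
    show "\<sigma> \<circ> (g \<circ> \<tau> \<circ> inv' g) \<noteq> g \<circ> \<tau> \<circ> inv' g \<circ> \<sigma>"
    proof
      assume "\<sigma> \<circ> (g \<circ> \<tau> \<circ> inv' g) = g \<circ> \<tau> \<circ> inv' g \<circ> \<sigma>"
      from fun_cong[OF this, of a] show False using i ne by simp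
    qed
  qed
  show thesis
  proof (cases "\<exists>c. \<tau> c \<noteq> c \<and> \<tau> (\<tau> c) \<noteq> c")
    case True
    then obtain c where c: "\<tau> c \<noteq> c" "\<tau> (\<tau> c) \<noteq> c" by blast
    have ct: "c \<in> {1..t}" using permutes_not_in[OF p\<tau>, of c] c by blast
    have dt: "\<tau> c \<in> {1..t}" "\<tau> (\<tau> c) \<in> {1..t}" using permutes_in_image[OF p\<tau>] ct by blast+
    obtain x where x: "x \<in> {1..t}" "x \<notin> {a, \<sigma> a, \<sigma> (\<sigma> a), a}" using pick[OF c4] by blast
    have "\<tau> (\<tau> c) \<noteq> \<tau> c" using c(1) inj(2) by (simp add: inj_eq)
    then obtain g where g: "g \<in> carrier (alt_group t)" "map g [c, \<tau> c, \<tau> (\<tau> c)] = [a, \<sigma> a, x]"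
      using ext[of "[c, \<tau> c, \<tau> (\<tau> c)]" "[a, \<sigma> a, x]"] c ct dt x at a t by auto
    show thesis by (rule finish[OF g(1), of c "\<tau> c"]) (use g(2) x in auto)
  next
    case False
    obtain c where c: "\<tau> c \<noteq> c" using \<tau>(2) by (auto simp: fun_eq_iff)
    then have cc: "\<tau> (\<tau> c) = c" using False by blast
    have ct: "c \<in> {1..t}" using permutes_not_in[OF p\<tau>, of c] c by blast
    have dt: "\<tau> c \<in> {1..t}" using permutes_in_image[OF p\<tau>] ct by blast
    obtain e where e: "e \<in> {1..t}" "e \<notin> {a, \<sigma> a, a, a}" using pick[OF c4] by blast
    show thesis
    proof (cases "\<exists>f\<in>{1..t}. \<tau> f = f")
      case True
      then obtain f where f: "f \<in> {1..t}" "\<tau> f = f" by blast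
      have "f \<noteq> c" "f \<noteq> \<tau> c" using f(2) c cc by auto
      then obtain g where g: "g \<in> carrier (alt_group t)" "map g [c, \<tau> c, f] = [a, e, \<sigma> a]"
        using ext[of "[c, \<tau> c, f]" "[a, e, \<sigma> a]"] c ct dt f(1) e at a t by auto
      show thesis by (rule finish[OF g(1), of c f]) (use g(2) e f(2) inj(1) in \<open>auto simp: inj_eq\<close>)
    next
      case nofix: False
      obtain f where f: "f \<in> {1..t}" "f \<notin> {c, \<tau> c, c, c}" using pick[OF c4] by blast
      have k: "\<tau> f \<noteq> f" "\<tau> (\<tau> f) = f" "\<tau> f \<in> {1..t}"
        using nofix False f(1) permutes_in_image[OF p\<tau>] by blast+
      have kc: "\<tau> f \<noteq> c" "\<tau> f \<noteq> \<tau> c" using f(2) inj(2) cc k(2) by (auto simp: inj_eq)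
      \<comment> \<open>A fixed-point-free involution has an even number of points.\<close>
      have "t \<noteq> 5"
      proof
        assume "t = 5"
        obtain z where z: "z \<in> {1..t}" "z \<notin> {c, \<tau> c, f, \<tau> f}" using pick[OF c4] by blast
        have zt: "\<tau> z \<in> {1..t}" using permutes_in_image[OF p\<tau>] z(1) by blast
        have zn: "\<tau> z \<noteq> z" using nofix z(1) by blast
        have "\<tau> z \<noteq> c" "\<tau> z \<noteq> \<tau> c" "\<tau> z \<noteq> f" "\<tau> z \<noteq> \<tau> f"
          using z(2) cc k(2) inj(2) by (auto simp: inj_eq)
        then have "card {c, \<tau> c, f, \<tau> f, z, \<tau> z} = 6"
          using c f(2) k(1) kc z(2) zn by (auto simp: card_insert_if)
        moreover have "card {c, \<tau> c, f, \<tau> f, z, \<tau> z} \<le> card {1..t}"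
          using ct dt f(1) k(3) z(1) zt by (intro card_mono) auto
        ultimately show False using \<open>t = 5\<close> by simp
      qed
      then have t6: "t \<ge> 6" using t by simp
      obtain y where y: "y \<in> {1..t}" "y \<notin> {a, \<sigma> a, e, \<sigma> e}" using pick[OF c4] by blast
      obtain g where g: "g \<in> carrier (alt_group t)" "map g [c, \<tau> c, f, \<tau> f] = [a, e, \<sigma> a, y]"
        using ext[of "[c, \<tau> c, f, \<tau> f]" "[a, e, \<sigma> a, y]"] c ct dt f k kc e y at a t6 by auto
      show thesis by (rule finish[OF g(1), of c f]) (use g(2) y in auto)
    qed
  qed
qed

text \<open>Squares in \<open>Sym(3)\<close> are rotations.\<close>

lemma squares_commute_sym3:
  assumes n: "n = (3::nat)" and pn: "p permutes {1..n}" and qn: "q permutes {1..n}"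
  shows "p (p (q (q x))) = q (q (p (p x)))"
proof -
  note p = pn[unfolded n] and q = qn[unfolded n]
  have rot: "(r (r 1), r (r 2), r (r 3)) \<in> {(1,2,3), (2,3,1), (3,1,2)}" if r: "r permutes {1..3}" for r :: "nat \<Rightarrow> nat"
  proof -
    have "r 1 \<in> {1..3}" "r 2 \<in> {1..3}" "r 3 \<in> {1..3}" using permutes_in_image[OF r] by simp_all
    then have "r 1 \<in> {1, 2, 3}" "r 2 \<in> {1, 2, 3}" "r 3 \<in> {1, 2, 3}" by auto
    moreover have "r 1 \<noteq> r 2" "r 1 \<noteq> r 3" "r 2 \<noteq> r 3" using permutes_inj[OF r] by (simp_all add: inj_eq)
    ultimately show ?thesis by (elim insertE emptyE) simp_all
  qed
  show ?thesis
  proof (cases "x \<in> {1..3}")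
    case True
    then have "x \<in> {1, 2, 3}" by auto
    then show ?thesis using rot[OF p] rot[OF q] by auto
  next
    case False
    then show ?thesis using permutes_not_in[OF p] permutes_not_in[OF q] by simp
  qed
qed

lemma has_section_imp_hom:
  assumes G: "group G" and S: "has_section G S"
  obtains H \<phi> where "subgroup H G" "\<phi> \<in> hom (G\<lparr>carrier := H\<rparr>) S" "\<phi> ` H = carrier S"
proof -
  obtain H N where HN: "subgroup H G" "N \<lhd> (G\<lparr>carrier := H\<rparr>)" "(G\<lparr>carrier := H\<rparr>) Mod N \<cong> S"
    using S unfolding has_section_def by blast
  obtain \<psi> where \<psi>: "\<psi> \<in> iso ((G\<lparr>carrier := H\<rparr>) Mod N) S" using HN(3) unfolding is_iso_def by blast
  let ?q = "\<lambda>a. N #>\<^bsub>G\<lparr>carrier := H\<rparr>\<^esub> a"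
  have q: "?q \<in> hom (G\<lparr>carrier := H\<rparr>) ((G\<lparr>carrier := H\<rparr>) Mod N)"
    by (rule normal.r_coset_hom_Mod[OF HN(2)])
  have "\<psi> \<in> hom ((G\<lparr>carrier := H\<rparr>) Mod N) S" using \<psi> by (simp add: iso_def)
  then have "(\<psi> \<circ> ?q) \<in> hom (G\<lparr>carrier := H\<rparr>) S" by (rule hom_compose[OF q])
  moreover have "?q ` H = carrier ((G\<lparr>carrier := H\<rparr>) Mod N)"
    by (auto simp: FactGroup_def RCOSETS_def)
  then have "(\<psi> \<circ> ?q) ` H = carrier S"
    using \<psi> unfolding iso_def bij_betw_def image_comp[symmetric] by simp
  ultimately show thesis using HN(1) that by blast
qed

lemma injective_hom_imp_section:
  assumes G: "group G" and S: "group S" and h: "h \<in> hom S G" "inj_on h (carrier S)"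
  shows "has_section G S"
proof -
  interpret gh: group_hom S G h using G S h(1) by (simp add: group_hom_def group_hom_axioms_def)
  let ?H = "h ` carrier S"
  have sub: "subgroup ?H G" by (rule gh.img_is_subgroup)
  interpret GH: group "G\<lparr>carrier := ?H\<rparr>" by (rule group.subgroup_imp_group[OF G sub])
  let ?N = "{\<one>\<^bsub>G\<lparr>carrier := ?H\<rparr>\<^esub>}"
  have N: "?N \<lhd> (G\<lparr>carrier := ?H\<rparr>)" by (rule GH.one_is_normal)
  have "h \<in> iso S (G\<lparr>carrier := ?H\<rparr>)"
    using h by (auto simp: iso_def hom_def bij_betw_def)
  then have "S \<cong> (G\<lparr>carrier := ?H\<rparr>)" unfolding is_iso_def by blast
  then have "(G\<lparr>carrier := ?H\<rparr>) \<cong> S" by (rule group.iso_sym[OF S])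
  moreover have "(G\<lparr>carrier := ?H\<rparr>) Mod ?N \<cong> (G\<lparr>carrier := ?H\<rparr>)"
    using GH.trivial_factor_iso unfolding is_iso_def by auto
  ultimately have "(G\<lparr>carrier := ?H\<rparr>) Mod ?N \<cong> S" by (rule iso_trans[rotated])
  then show ?thesis unfolding has_section_def using sub N by blast
qed

section \<open>Thickness of the automorphism group\<close>

text \<open>This makes a 3-cycle equal to its own fourth power.\<close>

lemma three_cycle_cubed:
  assumes "s \<in> three_cycles t" shows "s (s (s x)) = x"
proof -
  obtain cs where cs: "s = cycle_of_list cs" "cycle cs" "length cs = 3" using assms by auto
  obtain a b c where abc: "cs = [a, b, c]" using stupid_lemma[OF cs(3)] by blast
  have d: "a \<noteq> b" "b \<noteq> c" "a \<noteq> c" using cs(2) unfolding abc by auto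
  have s: "s y = transpose a b (transpose b c y)" for y unfolding cs(1) abc by simp
  show ?thesis using d unfolding s transpose_def by simp
qed

context hamming_sandwich
begin

lemma group_G: "group G"
  by (rule group_Aut)

lemma mult_G: "mult G = (\<circ>)" and one_G: "\<one>\<^bsub>G\<^esub> = id"
  by (simp_all add: Aut_def)

lemma comp_in_G: "g \<in> carrier G \<Longrightarrow> h \<in> carrier G \<Longrightarrow> g \<circ> h \<in> carrier G"
  using monoid.m_closed[OF group.is_monoid[OF group_G]] by (simp add: mult_G)

lemma G_closed: "g \<in> carrier G \<Longrightarrow> u \<in> V \<Longrightarrow> g u \<in> V"
  using permutes_in_image[OF Aut_permutes] by blast

text \<open>The normal subgroup \<open>Sym(m)\<^sup>d\<close> of the automorphisms that fix every coordinate position.\<close>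

definition base :: "('v \<Rightarrow> 'v) set" where
  "base = {g \<in> carrier G. \<forall>u\<in>V. \<forall>v\<in>V. diff (g u) (g v) = diff u v}"

text \<open>The components of an element of the base group; for other automorphisms the value is
  meaningless.\<close>

definition loc :: "('v \<Rightarrow> 'v) \<Rightarrow> nat \<Rightarrow> nat \<Rightarrow> nat" where
  "loc g = (SOME \<sigma>. (\<forall>i<d. \<sigma> i permutes {1..m}) \<and> g = wreath id \<sigma>)"

lemma loc_props:
  assumes "g \<in> base"
  shows "(\<forall>i<d. loc g i permutes {1..m}) \<and> g = wreath id (loc g)"
proof -
  have "g permutes V" "\<And>u v. u \<in> V \<Longrightarrow> v \<in> V \<Longrightarrow> diff (g u) (g v) = id ` diff u v"
    using assms Aut_permutes unfolding base_def by auto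
  then obtain \<sigma> where "\<sigma> \<in> {..<d} \<rightarrow>\<^sub>E {s. s permutes {1..m}}" "g = wreath id \<sigma>"
    using wreath_exhaust[OF permutes_id] by blast
  then have "\<exists>\<sigma>. (\<forall>i<d. \<sigma> i permutes {1..m}) \<and> g = wreath id \<sigma>" by (auto simp: PiE_iff)
  from someI_ex[OF this] show ?thesis unfolding loc_def .
qed

lemma loc_permutes: "g \<in> base \<Longrightarrow> i < d \<Longrightarrow> loc g i permutes {1..m}"
  using loc_props by blast

lemma coord_loc:
  assumes g: "g \<in> base" and u: "u \<in> V" and i: "i < d"
  shows "coord (g u) i = loc g i (coord u i)"
  using wreath_coord[OF permutes_id _ u i, of "loc g"] loc_props[OF g] by simp

lemma base_carrier: "g \<in> base \<Longrightarrow> g \<in> carrier G"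
  by (simp add: base_def)

lemma base_comp: "g \<in> base \<Longrightarrow> h \<in> base \<Longrightarrow> g \<circ> h \<in> base"
  using comp_in_G G_closed by (auto simp: base_def)

lemma base_eqI:
  assumes g: "g \<in> base" and h: "h \<in> base"
    and eq: "\<And>i x. i < d \<Longrightarrow> loc g i x = loc h i x"
  shows "g = h"
proof
  fix u show "g u = h u"
  proof (cases "u \<in> V")
    case True
    then show ?thesis using coord_loc[OF g True] coord_loc[OF h True] eq
      by (intro coord_eqI[OF G_closed[OF base_carrier[OF g] True] G_closed[OF base_carrier[OF h] True]]) auto
  next
    case False
    then show ?thesis
      using permutes_not_in[OF Aut_permutes[OF base_carrier]] g h by metis
  qed
qed

lemma loc_eqI:
  assumes g: "g \<in> base" and i: "i < d" and p: "p permutes {1..m}"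
    and eq: "\<And>u. u \<in> V \<Longrightarrow> coord (g u) i = p (coord u i)"
  shows "loc g i = p"
proof
  fix x show "loc g i x = p x"
  proof (cases "x \<in> {1..m}")
    case True
    then obtain u where "u \<in> V" "coord u i = x" using obtain_coord[OF i] by blast
    then show ?thesis using eq[of u] coord_loc[OF g _ i, of u] by simp
  next
    case False
    then show ?thesis using permutes_not_in[OF p] permutes_not_in[OF loc_permutes[OF g i]] by metis
  qed
qed

lemma loc_comp:
  assumes "g \<in> base" "h \<in> base" "i < d"
  shows "loc (g \<circ> h) i = loc g i \<circ> loc h i"
proof (rule loc_eqI[OF base_comp[OF assms(1,2)] assms(3)])
  show "loc g i \<circ> loc h i permutes {1..m}"
    using assms loc_permutes by (intro permutes_compose) auto
next
  fix u assume u: "u \<in> V"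
  have "h u \<in> V" by (rule G_closed[OF base_carrier[OF assms(2)] u])
  then show "coord ((g \<circ> h) u) i = (loc g i \<circ> loc h i) (coord u i)"
    using coord_loc assms u by simp
qed

lemma id_base: "id \<in> base"
  using group.is_monoid[OF group_G] monoid.one_closed by (fastforce simp: base_def one_G)

lemma loc_id: "i < d \<Longrightarrow> loc id i = id"
  by (rule loc_eqI[OF id_base _ permutes_id]) auto

text \<open>Letting \<open>Alt(m)\<close> act on the letters at position \<open>0\<close> embeds it into the automorphism group.\<close>

lemma alternating_section_of_Aut:
  assumes d: "d > 0"
  shows "has_section G (alt_group m)"
proof (rule injective_hom_imp_section[OF group_G alt_group_is_group])
  define \<sigma> where "\<sigma> s i = (if i = 0 then s else id)" for s :: "nat \<Rightarrow> nat" and i :: nat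
  have \<sigma>: "\<forall>i<d. \<sigma> s i permutes {1..m}" if "s permutes {1..m}" for s
    using that by (simp add: \<sigma>_def permutes_id)
  have b: "wreath id (\<sigma> s) \<in> base" if "s permutes {1..m}" for s
    using wreath_in_Aut[OF id_in_stab \<sigma>[OF that]] wreath_diff[OF permutes_id \<sigma>[OF that]]
    unfolding base_def by simp
  have l: "loc (wreath id (\<sigma> s)) i = \<sigma> s i" if s: "s permutes {1..m}" and i: "i < d" for s i
    by (rule loc_eqI[OF b[OF s] i]) (use \<sigma>[OF s] wreath_coord[OF permutes_id \<sigma>[OF s] _ i] i in auto)
  show "(\<lambda>s. wreath id (\<sigma> s)) \<in> hom (alt_group m) G"
  proof (rule homI)
    fix s assume "s \<in> carrier (alt_group m)"
    then show "wreath id (\<sigma> s) \<in> carrier G"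
      using b base_carrier by (simp add: alt_group_carrier)
  next
    fix s r assume sr: "s \<in> carrier (alt_group m)" "r \<in> carrier (alt_group m)"
    then have p: "s permutes {1..m}" "r permutes {1..m}" by (simp_all add: alt_group_carrier)
    note pc = permutes_compose[OF p(2,1)]
    have "wreath id (\<sigma> (s \<circ> r)) = wreath id (\<sigma> s) \<circ> wreath id (\<sigma> r)"
      by (rule base_eqI[OF b[OF pc] base_comp[OF b[OF p(1)] b[OF p(2)]]])
        (use p pc in \<open>simp add: loc_comp b l \<sigma>_def\<close>)
    then show "wreath id (\<sigma> (s \<otimes>\<^bsub>alt_group m\<^esub> r)) = wreath id (\<sigma> s) \<otimes>\<^bsub>G\<^esub> wreath id (\<sigma> r)"
      by (simp add: mult_G alt_group_mult)
  qed
  show "inj_on (\<lambda>s. wreath id (\<sigma> s)) (carrier (alt_group m))"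
  proof (rule inj_onI)
    fix s r assume "s \<in> carrier (alt_group m)" "r \<in> carrier (alt_group m)" and eq: "wreath id (\<sigma> s) = wreath id (\<sigma> r)"
    then have "\<sigma> s 0 = \<sigma> r 0" using l[of s 0] l[of r 0] d by (simp add: alt_group_carrier)
    then show "s = r" by (simp add: \<sigma>_def)
  qed
qed

text \<open>Suppose that for every \<open>i\<close> some element of \<open>H\<close> with trivial component at \<open>i\<close> has a nontrivial image.
  The commutator of an element trivial on \<open>S\<close> and an element trivial at \<open>i\<close> is trivial on
  \<open>insert i S\<close>, and after conjugating the second one the image of the commutator is nontrivial.
  So there are such elements for all sets of coordinates. For the set of all coordinates this is
  absurd.\<close>

lemma one_coordinate_decides:
  assumes H: "subgroup H G" and \<phi>: "\<phi> \<in> hom (G\<lparr>carrier := H\<rparr>) (alt_group t)"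
    and onto: "\<phi> ` (H \<inter> base) = carrier (alt_group t)" and t: "t \<ge> 5"
  obtains i where "i < d" "\<And>h. h \<in> H \<inter> base \<Longrightarrow> loc h i = id \<Longrightarrow> \<phi> h = id"
proof -
  interpret A: group "alt_group t" by (rule alt_group_is_group)
  interpret GG: group G by (rule group_G)
  interpret HH: group "G\<lparr>carrier := H\<rparr>" by (rule GG.subgroup_imp_group[OF H])
  interpret hom: group_hom "G\<lparr>carrier := H\<rparr>" "alt_group t" \<phi>
    using \<phi> by unfold_locales
  have HG: "h \<in> carrier G" if "h \<in> H" for h using subgroup.mem_carrier[OF H that] .
  have \<phi>mult: "\<phi> (g \<circ> h) = \<phi> g \<circ> \<phi> h" if "g \<in> H" "h \<in> H" for g h
    using hom.hom_mult[of g h] that by (simp add: mult_G alt_group_mult)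
  have \<phi>id: "\<phi> id = id" using hom.hom_one by (simp add: one_G alt_group_one)
  have Hcomp: "g \<circ> h \<in> H" if "g \<in> H" "h \<in> H" for g h
    using subgroup.m_closed[OF H that] by (simp add: mult_G)
  have inv: "inv' h \<in> H \<inter> base \<and> h \<circ> inv' h = id \<and> inv' h \<circ> h = id \<and> \<phi> (inv' h) = inv' (\<phi> h)"
    if h: "h \<in> H \<inter> base" for h
  proof -
    have p: "h permutes V" using Aut_permutes[OF base_carrier] h by blast
    have o: "h \<circ> inv' h = id" "inv' h \<circ> h = id" using permutes_inv_o[OF p] by auto
    have "inv\<^bsub>G\<^esub> h = inv' h"
    proof -
      have "inv\<^bsub>G\<^esub> h = inv\<^bsub>G\<^esub> h \<circ> (h \<circ> inv' h)" by (simp add: o)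
      also have "\<dots> = (inv\<^bsub>G\<^esub> h \<circ> h) \<circ> inv' h" by (simp add: comp_assoc)
      also have "inv\<^bsub>G\<^esub> h \<circ> h = id" using GG.l_inv[of h] HG h by (simp add: mult_G one_G)
      finally show ?thesis by simp
    qed
    then have H': "inv' h \<in> H" using subgroup.m_inv_closed[OF H, of h] h by simp
    have "diff (inv' h u) (inv' h v) = diff u v" if "u \<in> V" "v \<in> V" for u v
    proof -
      have "inv' h u \<in> V" "inv' h v \<in> V" using permutes_in_image[OF permutes_inv[OF p]] that by blast+
      then have "diff (h (inv' h u)) (h (inv' h v)) = diff (inv' h u) (inv' h v)"
        using h unfolding base_def by blast
      then show ?thesis by (simp add: permutes_inverses(1)[OF p])
    qed
    then have B: "inv' h \<in> base" using HG[OF H'] unfolding base_def by blast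
    have "\<phi> (inv' h) \<circ> \<phi> h = id" using \<phi>mult[OF H', of h] h unfolding o(2) \<phi>id by simp
    moreover have "\<phi> h permutes {1..t}" using onto h alt_group_carrier by blast
    ultimately have "\<phi> (inv' h) = inv' (\<phi> h)"
      by (metis comp_assoc comp_id id_comp permutes_inv_o(1))
    then show ?thesis using H' B o by blast
  qed
  have "\<exists>i<d. \<forall>h\<in>H \<inter> base. loc h i = id \<longrightarrow> \<phi> h = id"
  proof (rule ccontr)
    assume neg: "\<not> ?thesis"
    have "\<exists>h\<in>H \<inter> base. (\<forall>i\<in>S. loc h i = id) \<and> \<phi> h \<noteq> id" if "finite S" "S \<subseteq> {..<d}" for S
      using that
    proof (induction S)
      case empty
      have "card (carrier (alt_group t)) \<noteq> 1"
      proof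
        assume "card (carrier (alt_group t)) = 1"
        then have "fact t = (2::nat)" using alt_group_card_carrier[of t] t by simp
        moreover have "fact 5 \<le> (fact t :: nat)" using t by (rule fact_mono)
        ultimately show False by (simp add: fact_numeral)
      qed
      moreover have "carrier (alt_group t) = {id}" if "\<forall>s\<in>carrier (alt_group t). s = id"
        using that A.one_closed by (auto simp: alt_group_one)
      ultimately obtain s where "s \<in> carrier (alt_group t)" "s \<noteq> id" by fastforce
      then show ?case using onto by (metis empty_iff imageE)
    next
      case (insert i S)
      then obtain x where x: "x \<in> H \<inter> base" "\<forall>i\<in>S. loc x i = id" "\<phi> x \<noteq> id"
        by (metis insert_subset)
      obtain y where y: "y \<in> H \<inter> base" "loc y i = id" "\<phi> y \<noteq> id"
        using neg insert.prems by auto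
      have "\<phi> x \<in> carrier (alt_group t)" "\<phi> y \<in> carrier (alt_group t)" using onto x y by blast+
      then obtain s where s: "s \<in> carrier (alt_group t)"
        "\<phi> x \<circ> (s \<circ> \<phi> y \<circ> inv' s) \<noteq> (s \<circ> \<phi> y \<circ> inv' s) \<circ> \<phi> x"
        using alt_group_noncommuting_conjugate[OF t _ x(3) _ y(3)] by blast
      obtain k where k: "k \<in> H \<inter> base" "\<phi> k = s" using onto s(1) by (metis imageE)
      define z where "z = k \<circ> y \<circ> inv' k"
      have z: "z \<in> H \<inter> base" unfolding z_def using k y inv[OF k(1)] Hcomp base_comp by auto
      have \<phi>z: "\<phi> z = s \<circ> \<phi> y \<circ> inv' s"
        unfolding z_def using k y inv[OF k(1)] Hcomp \<phi>mult by auto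
      \<comment> \<open>At every position of \<open>insert i S\<close> one of \<open>x\<close>, \<open>z\<close> is trivial, hence so is their
        commutator.\<close>
      define w where "w = x \<circ> z \<circ> (inv' x \<circ> inv' z)"
      have w: "w \<in> H \<inter> base" unfolding w_def using x z inv[OF x(1)] inv[OF z] Hcomp base_comp by auto
      have lz: "loc g j \<circ> loc (inv' g) j = id" if "g \<in> H \<inter> base" "j < d" for g j
        using inv[OF that(1)] that loc_comp[of g "inv' g" j] loc_id by auto
      have lzi: "loc z i = id"
      proof -
        have "i < d" using insert.prems by simp
        then have "loc z i = loc k i \<circ> loc y i \<circ> loc (inv' k) i"
          unfolding z_def using k(1) y(1) inv[OF k(1)] base_comp loc_comp by auto
        then show ?thesis using y(2) lz[OF k(1) \<open>i < d\<close>] by simp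
      qed
      have lw: "loc w j = loc x j \<circ> loc z j \<circ> (loc (inv' x) j \<circ> loc (inv' z) j)" if "j < d" for j
        unfolding w_def using x(1) z inv[OF x(1)] inv[OF z] base_comp loc_comp that by auto
      have "loc w j = id" if jS: "j \<in> insert i S" for j
      proof -
        have jd: "j < d" using jS insert.prems by auto
        consider "loc x j = id" | "loc z j = id"
        proof (cases "j = i")
          case False
          then have "loc x j = id" using jS x(2) by simp
          then show thesis by (rule that(1))
        qed (use lzi that in simp)
        then show ?thesis
        proof cases
          case 1
          then have "loc (inv' x) j = id" using lz[OF x(1) jd] by simp
          then show ?thesis using lw[OF jd] 1 lz[OF z jd] by simp
        next
          case 2
          then have "loc (inv' z) j = id" using lz[OF z jd] by simp
          then show ?thesis using lw[OF jd] 2 lz[OF x(1) jd] by simp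
        qed
      qed
      moreover have "\<phi> w \<noteq> id"
      proof
        assume "\<phi> w = id"
        have zx: "z \<circ> x \<in> H" "x \<circ> z \<in> H" using x z Hcomp by auto
        have "w \<circ> (z \<circ> x) = x \<circ> z"
        proof -
          have "w \<circ> (z \<circ> x) = x \<circ> z \<circ> (inv' x \<circ> ((inv' z \<circ> z) \<circ> x))"
            unfolding w_def by (simp only: comp_assoc)
          also have "\<dots> = x \<circ> z" using inv[OF x(1)] inv[OF z] by simp
          finally show ?thesis .
        qed
        then have "\<phi> w \<circ> \<phi> (z \<circ> x) = \<phi> (x \<circ> z)" using \<phi>mult[of w "z \<circ> x"] w zx by simp
        then have "\<phi> z \<circ> \<phi> x = \<phi> x \<circ> \<phi> z" using \<open>\<phi> w = id\<close> \<phi>mult x(1) z by simp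
        then show False using s(2) \<phi>z by simp
      qed
      ultimately show ?case using w by blast
    qed
    from this[of "{..<d}"] obtain h where h: "h \<in> H \<inter> base" "\<forall>i\<in>{..<d}. loc h i = id" "\<phi> h \<noteq> id"
      by auto
    have "h = id" by (rule base_eqI[OF _ id_base]) (use h loc_id in auto)
    then show False using h(3) \<phi>id by simp
  qed
  then show thesis using that by blast
qed

end

context hamming_sandwich
begin

text \<open>Fourth powers of elements of \<open>H\<close> lie in the base group. They are mapped onto all 3-cycles, and
  these generate \<open>Alt(t)\<close>.\<close>

lemma alternating_section_of_Aut_le:
  assumes exp4: "\<And>\<pi>. \<pi> \<in> stab \<Longrightarrow> \<pi> ^^ 4 = id" and sec: "has_section G (alt_group t)"
  shows "t \<le> m"
proof (rule ccontr)
  assume "\<not> t \<le> m"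
  then have tm: "Suc m \<le> t" by simp
  obtain H \<phi> where H: "subgroup H G" and \<phi>: "\<phi> \<in> hom (G\<lparr>carrier := H\<rparr>) (alt_group t)"
    and \<phi>H: "\<phi> ` H = carrier (alt_group t)"
    using has_section_imp_hom[OF group_G sec] by blast
  interpret A: group "alt_group t" by (rule alt_group_is_group)
  interpret GG: group G by (rule group_G)
  interpret HH: group "G\<lparr>carrier := H\<rparr>" by (rule GG.subgroup_imp_group[OF H])
  interpret hom: group_hom "G\<lparr>carrier := H\<rparr>" "alt_group t" \<phi>
    using \<phi> by unfold_locales
  have HG: "h \<in> carrier G" if "h \<in> H" for h using subgroup.mem_carrier[OF H that] .
  have \<phi>mult: "\<phi> (g \<circ> h) = \<phi> g \<circ> \<phi> h" if "g \<in> H" "h \<in> H" for g h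
    using hom.hom_mult[of g h] that by (simp add: mult_G alt_group_mult)
  have Hcomp: "g \<circ> h \<in> H" if "g \<in> H" "h \<in> H" for g h
    using subgroup.m_closed[OF H that] by (simp add: mult_G)
  have fourth: "h \<circ> h \<circ> (h \<circ> h) \<in> base" if h: "h \<in> H" for h
  proof -
    have hG: "h \<in> carrier G" using HG[OF h] .
    obtain \<pi> where \<pi>: "\<pi> \<in> stab" "\<And>u v. u \<in> V \<Longrightarrow> v \<in> V \<Longrightarrow> diff (h u) (h v) = \<pi> ` diff u v"
      using Aut_direction[OF hG] by blast
    have "diff (h (h (h (h u)))) (h (h (h (h v)))) = diff u v" if uv: "u \<in> V" "v \<in> V" for u v
    proof -
      have "diff (h (h (h (h u)))) (h (h (h (h v)))) = (\<pi> ^^ 4) ` diff u v"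
        using \<pi>(2) G_closed[OF hG] uv by (simp add: numeral_eq_Suc image_comp)
      then show ?thesis by (simp add: exp4[OF \<pi>(1)])
    qed
    then show ?thesis using comp_in_G hG unfolding base_def by simp
  qed
  have subB: "subgroup (H \<inter> base) (G\<lparr>carrier := H\<rparr>)"
  proof (rule HH.subgroupI)
    show "H \<inter> base \<noteq> {}" using id_base subgroup.one_closed[OF H] by (auto simp: one_G)
    fix a assume a: "a \<in> H \<inter> base"
    have p: "a permutes V" using Aut_permutes[OF base_carrier] a by blast
    let ?b = "inv\<^bsub>G\<lparr>carrier := H\<rparr>\<^esub> a"
    have b: "?b \<in> H" using HH.inv_closed[of a] a by simp
    have ab: "a \<circ> ?b = id" using HH.r_inv[of a] a by (simp add: mult_G one_G)
    have "diff (?b u) (?b v) = diff u v" if "u \<in> V" "v \<in> V" for u v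
    proof -
      have "?b u \<in> V" "?b v \<in> V" using G_closed[OF HG[OF b]] that by blast+
      then have "diff (a (?b u)) (a (?b v)) = diff (?b u) (?b v)"
        using a unfolding base_def by blast
      then show ?thesis using fun_cong[OF ab] by simp
    qed
    then show "?b \<in> H \<inter> base" using b HG[OF b] unfolding base_def by blast
  qed (use Hcomp base_comp in \<open>auto simp: mult_G\<close>)
  have cyc: "\<exists>h\<in>H. \<phi> h = s \<and> \<phi> (h \<circ> h \<circ> (h \<circ> h)) = s" if s: "s \<in> three_cycles t" for s
  proof -
    have "s \<in> carrier (alt_group t)" using three_cycles_incl s by blast
    then obtain h where h: "h \<in> H" "\<phi> h = s" using \<phi>H by (metis imageE)
    have "\<phi> (h \<circ> h \<circ> (h \<circ> h)) = s \<circ> s \<circ> (s \<circ> s)" using \<phi>mult Hcomp h by simp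
    also have "\<dots> = s" using three_cycle_cubed[OF s] by (auto simp: fun_eq_iff)
    finally show ?thesis using h by blast
  qed
  have onto: "\<phi> ` (H \<inter> base) = carrier (alt_group t)"
  proof
    show "\<phi> ` (H \<inter> base) \<subseteq> carrier (alt_group t)" using \<phi>H by blast
    have "three_cycles t \<subseteq> \<phi> ` (H \<inter> base)"
    proof
      fix s assume "s \<in> three_cycles t"
      then obtain h where "h \<in> H" "\<phi> (h \<circ> h \<circ> (h \<circ> h)) = s" using cyc by blast
      then show "s \<in> \<phi> ` (H \<inter> base)" using fourth Hcomp by (metis IntI image_eqI)
    qed
    then have "generate (alt_group t) (three_cycles t) \<subseteq> \<phi> ` (H \<inter> base)"
      by (rule A.generate_subgroup_incl) (rule hom.subgroup_img_is_subgroup[OF subB])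
    then show "carrier (alt_group t) \<subseteq> \<phi> ` (H \<inter> base)"
      using alt_group_carrier_as_three_cycles by blast
  qed
  show False
  proof (cases "t \<ge> 5")
    case True
    obtain i where i: "i < d" "\<And>h. h \<in> H \<inter> base \<Longrightarrow> loc h i = id \<Longrightarrow> \<phi> h = id"
      using one_coordinate_decides[OF H \<phi> onto True] by blast
    \<comment> \<open>So \<open>\<phi>\<close> is determined by the component at \<open>i\<close>, and \<open>Alt(t)\<close> has at most \<open>m!\<close> elements.\<close>
    have same: "\<phi> g = \<phi> h" if gh: "g \<in> H \<inter> base" "h \<in> H \<inter> base" "loc g i = loc h i" for g h
    proof -
      let ?b = "inv\<^bsub>G\<lparr>carrier := H\<rparr>\<^esub> h"
      have b: "?b \<in> H \<inter> base" using subgroup.m_inv_closed[OF subB gh(2)] .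
      have bh: "?b \<circ> h = id" using HH.l_inv[of h] gh(2) by (simp add: mult_G one_G)
      have hb: "h \<circ> ?b = id" using HH.r_inv[of h] gh(2) by (simp add: mult_G one_G)
      have "loc (?b \<circ> g) i = loc (?b \<circ> h) i" using gh b i(1) by (simp add: loc_comp)
      also have "\<dots> = id" unfolding bh by (rule loc_id[OF i(1)])
      finally have "\<phi> (?b \<circ> g) = id" using i(2)[of "?b \<circ> g"] b gh(1) Hcomp base_comp by blast
      moreover have "h \<circ> (?b \<circ> g) = g" unfolding comp_assoc[symmetric] hb by simp
      moreover have "?b \<circ> g \<in> H" using b gh(1) Hcomp by blast
      ultimately show ?thesis using \<phi>mult[of h "?b \<circ> g"] gh(2) by simp
    qed
    define k where "k s = (SOME h. h \<in> H \<inter> base \<and> \<phi> h = s)" for s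
    have k: "k s \<in> H \<inter> base \<and> \<phi> (k s) = s" if "s \<in> carrier (alt_group t)" for s
    proof -
      have "\<exists>h. h \<in> H \<inter> base \<and> \<phi> h = s" using that onto by (metis imageE)
      from someI_ex[OF this] show ?thesis unfolding k_def .
    qed
    have "card (carrier (alt_group t)) \<le> card {s. s permutes {1..m}}"
    proof (rule card_inj_on_le)
      show "inj_on (\<lambda>s. loc (k s) i) (carrier (alt_group t))"
        by (rule inj_onI) (metis k same)
      show "(\<lambda>s. loc (k s) i) ` carrier (alt_group t) \<subseteq> {s. s permutes {1..m}}"
        using k loc_permutes i(1) by blast
    qed (simp add: finite_permutations)
    also have "\<dots> = fact m" by (rule card_permutations) auto
    finally have "fact t \<le> (2 * fact m :: nat)"
      using alt_group_card_carrier[of t] True by simp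
    moreover have "fact (Suc m) \<le> (fact t :: nat)" using tm by (rule fact_mono)
    moreover have "4 * fact m \<le> (fact (Suc m) :: nat)" using m3 by simp
    moreover have "fact m > (0 :: nat)" by simp
    ultimately show False by linarith
  next
    case False
    then have t: "t = 4" "m = 3" using tm m3 by auto
    \<comment> \<open>Two 3-cycles whose squares do not commute.\<close>
    define s where "s = cycle_of_list [1, 2, 3 :: nat]"
    define r where "r = cycle_of_list [2, 3, 4 :: nat]"
    have "s \<in> three_cycles t" unfolding s_def
      by (intro CollectI exI[of _ "[1, 2, 3]"]) (simp add: t)
    moreover have "r \<in> three_cycles t" unfolding r_def
      by (intro CollectI exI[of _ "[2, 3, 4]"]) (simp add: t)
    ultimately have "s \<in> carrier (alt_group t)" "r \<in> carrier (alt_group t)"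
      using three_cycles_incl by blast+
    then have "s \<in> \<phi> ` (H \<inter> base)" "r \<in> \<phi> ` (H \<inter> base)" unfolding onto .
    then obtain g h where gh: "g \<in> H \<inter> base" "h \<in> H \<inter> base" "\<phi> g = s" "\<phi> h = r"
      by (elim imageE) simp
    have "g \<circ> g \<circ> (h \<circ> h) = h \<circ> h \<circ> (g \<circ> g)"
    proof (rule base_eqI)
      fix i x assume "i < d"
      then show "loc (g \<circ> g \<circ> (h \<circ> h)) i x = loc (h \<circ> h \<circ> (g \<circ> g)) i x"
        using gh squares_commute_sym3[OF t(2), of "loc g i" "loc h i" x] loc_permutes[of _ i]
        by (simp add: loc_comp base_comp)
    qed (use gh base_comp in auto)
    then have "\<phi> (g \<circ> g \<circ> (h \<circ> h)) = \<phi> (h \<circ> h \<circ> (g \<circ> g))" by simp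
    then have "s \<circ> s \<circ> (r \<circ> r) = r \<circ> r \<circ> (s \<circ> s)" using \<phi>mult Hcomp gh by simp
    from fun_cong[OF this, of 1] show False by (simp add: s_def r_def transpose_def)
  qed
qed

lemma thickness_Aut:
  assumes "d > 0" "\<And>\<pi>. \<pi> \<in> stab \<Longrightarrow> \<pi> ^^ 4 = id"
  shows "thickness G = m"
  unfolding thickness_def
  by (rule Greatest_equality) (use alternating_section_of_Aut[OF assms(1)] alternating_section_of_Aut_le[OF assms(2)] in auto)

end

section \<open>A typing of the subsets of an octagon\<close>

text \<open>The vertices of an octagon are numbered cyclically by \<open>0, ..., 7\<close>. The families are the
  vertices; the antipodal pairs; the pairs at distance two; the antipodal pairs together with the
  clockwise neighbour of one of their vertices; the pairs at distance two together with a third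
  vertex of the other parity, which is the vertex between them or its antipode if the pair is
  even, and one of the remaining two if the pair is odd; and the transversals of the four antipodal pairs that contain
  an even number of the vertices \<open>4, 5, 6, 7\<close>. The fourth family orients the cycle of the four
  antipodal pairs, and the fifth one is twisted in such a way that the odd rotations, which
  preserve the fourth, do not preserve it; the sixth one excludes the other permutations that
  exchange even and odd vertices.\<close>

definition octagon_blocks :: "nat list list list" where
  "octagon_blocks =
    [[[x]. x \<leftarrow> [0..<8]],
     [[x, x + 4]. x \<leftarrow> [0..<4]],
     [[x, (x + 2) mod 8]. x \<leftarrow> [0..<8]],
     [[x, (x + 1) mod 8, (x + 4) mod 8]. x \<leftarrow> [0..<8]],
     [[x, y, (x + 2) mod 8]. x \<leftarrow> [0..<8], y \<leftarrow> [0..<8], y mod 4 = (if even x then x + 1 else x + 3) mod 4],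
     [[w, x, y, z]. w \<leftarrow> [0, 4], x \<leftarrow> [1, 5], y \<leftarrow> [2, 6], z \<leftarrow> [3, 7], (w + x + y + z) mod 8 = 6]]"

text \<open>The type of a set counts, for each family, the blocks inside the set.\<close>

definition octagon_type :: "nat set \<Rightarrow> nat list" where
  "octagon_type A = map (\<lambda>Bs. length (filter (\<lambda>B. set B \<subseteq> A) Bs)) octagon_blocks"

text \<open>The same counts, written out for the indicator function of the set. In this form they
  can be computed by rewriting.\<close>

fun bits_type :: "bool list \<Rightarrow> nat list" where
  "bits_type [a0,a1,a2,a3,a4,a5,a6,a7] = map (\<lambda>bs. length (filter id bs))
    [[a0, a1, a2, a3, a4, a5, a6, a7],
     [a0\<and>a4, a1\<and>a5, a2\<and>a6, a3\<and>a7],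
     [a0\<and>a2, a1\<and>a3, a2\<and>a4, a3\<and>a5, a4\<and>a6, a5\<and>a7, a6\<and>a0, a7\<and>a1],
     [a0\<and>a1\<and>a4, a1\<and>a2\<and>a5, a2\<and>a3\<and>a6, a3\<and>a4\<and>a7, a4\<and>a5\<and>a0, a5\<and>a6\<and>a1, a6\<and>a7\<and>a2, a7\<and>a0\<and>a3],
     [a0\<and>a1\<and>a2, a0\<and>a5\<and>a2, a1\<and>a0\<and>a3, a1\<and>a4\<and>a3, a2\<and>a3\<and>a4, a2\<and>a7\<and>a4, a3\<and>a2\<and>a5, a3\<and>a6\<and>a5,
      a4\<and>a1\<and>a6, a4\<and>a5\<and>a6, a5\<and>a0\<and>a7, a5\<and>a4\<and>a7, a6\<and>a3\<and>a0, a6\<and>a7\<and>a0, a7\<and>a2\<and>a1, a7\<and>a6\<and>a1],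
     [a0\<and>a1\<and>a2\<and>a3, a0\<and>a1\<and>a6\<and>a7, a0\<and>a5\<and>a2\<and>a7, a0\<and>a5\<and>a6\<and>a3, a4\<and>a1\<and>a2\<and>a7, a4\<and>a1\<and>a6\<and>a3, a4\<and>a5\<and>a2\<and>a3, a4\<and>a5\<and>a6\<and>a7]]"
| "bits_type _ = []"

definition bits :: "nat set \<Rightarrow> bool list" where
  "bits A = map (\<lambda>i. i \<in> A) [0..<8]"

definition all_bits :: "bool list list" where
  "all_bits = List.n_lists 8 [False, True]"

lemma octagon_blocks_eval: "octagon_blocks =
  [[[0],[1],[2],[3],[4],[5],[6],[7]],
   [[0,4],[1,5],[2,6],[3,7]],
   [[0,2],[1,3],[2,4],[3,5],[4,6],[5,7],[6,0],[7,1]],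
   [[0,1,4],[1,2,5],[2,3,6],[3,4,7],[4,5,0],[5,6,1],[6,7,2],[7,0,3]],
   [[0,1,2],[0,5,2],[1,0,3],[1,4,3],[2,3,4],[2,7,4],[3,2,5],[3,6,5],
    [4,1,6],[4,5,6],[5,0,7],[5,4,7],[6,3,0],[6,7,0],[7,2,1],[7,6,1]],
   [[0,1,2,3],[0,1,6,7],[0,5,2,7],[0,5,6,3],[4,1,2,7],[4,1,6,3],[4,5,2,3],[4,5,6,7]]]"
  by code_simp

lemma upt_8: "[0..<8] = [0, 1, 2, 3, 4, 5, 6, 7]"
  by code_simp

lemma octagon_type_bits: "octagon_type A = bits_type (bits A)"
proof -
  have *: "octagon_type A = map (\<lambda>bs. length (filter id bs)) (map (map (\<lambda>B. set B \<subseteq> A)) octagon_blocks)"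
    by (simp add: octagon_type_def filter_map comp_def)
  have "bits A = [0 \<in> A, 1 \<in> A, 2 \<in> A, 3 \<in> A, 4 \<in> A, 5 \<in> A, 6 \<in> A, 7 \<in> A]"
    unfolding bits_def upt_8 by simp
  then show ?thesis unfolding * octagon_blocks_eval by (simp only: bits_type.simps) (simp only: list.map set_simps insert_subset empty_subsetI simp_thms)
qed

lemma bits_in_all_bits: "bits A \<in> set all_bits"
  by (auto simp: all_bits_def set_n_lists bits_def)

lemma all_bits_exhaust:
  assumes "xs \<in> set all_bits"
  obtains A where "A \<subseteq> {..<8}" "xs = bits A"
proof
  show "{i. i < 8 \<and> xs ! i} \<subseteq> {..<8}" by auto
  show "xs = bits {i. i < 8 \<and> xs ! i}"
    using assms by (intro nth_equalityI) (auto simp: all_bits_def set_n_lists bits_def)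
qed

definition down_types :: "bool list \<Rightarrow> nat list list" where
  "down_types xs = sort (map (\<lambda>i. bits_type (xs[i := False])) (filter (\<lambda>i. xs ! i) [0..<8]))"

definition up_types :: "bool list \<Rightarrow> nat list list" where
  "up_types xs = sort (map (\<lambda>i. bits_type (xs[i := True])) (filter (\<lambda>i. \<not> xs ! i) [0..<8]))"

text \<open>Inserts an entry into an association table and fails if the key is already present with
  another value. A table built in this way shows that the values are a function of the
  keys, and its length is the number of keys.\<close>

fun insert_entry :: "('k \<times> 'v) list \<Rightarrow> 'k \<times> 'v \<Rightarrow> ('k \<times> 'v) list option" where
  "insert_entry [] (k, v) = Some [(k, v)]"
| "insert_entry ((k', v') # r) (k, v) =
    (if k = k' then if v = v' then Some ((k', v') # r) else None
     else map_option ((#) (k', v')) (insert_entry r (k, v)))"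

fun table_of :: "('a \<Rightarrow> 'k \<times> 'v) \<Rightarrow> 'a list \<Rightarrow> ('k \<times> 'v) list \<Rightarrow> ('k \<times> 'v) list option" where
  "table_of f [] r = Some r"
| "table_of f (x # xs) r = (case insert_entry r (f x) of None \<Rightarrow> None | Some r' \<Rightarrow> table_of f xs r')"

lemma insert_entry_Some:
  "insert_entry r kv = Some r' \<Longrightarrow> distinct (map fst r) \<Longrightarrow>
    set r' = insert kv (set r) \<and> distinct (map fst r')"
proof (induction r kv arbitrary: r' rule: insert_entry.induct)
  case (2 k' v' r k v)
  show ?case
  proof (cases "k = k'")
    case True
    then show ?thesis using 2(2,3) by (auto split: if_splits)
  next
    case False
    then obtain r'' where r'': "insert_entry r (k, v) = Some r''" "r' = (k', v') # r''"
      using 2(2) by auto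
    then have "set r'' = insert (k, v) (set r) \<and> distinct (map fst r'')"
      using 2(1)[OF False] 2(3) by simp
    then show ?thesis using 2(3) False r''(2) by auto
  qed
qed auto

lemma table_of_Some:
  "table_of f xs r = Some r' \<Longrightarrow> distinct (map fst r) \<Longrightarrow>
    set r' = set r \<union> f ` set xs \<and> distinct (map fst r')"
proof (induction xs arbitrary: r)
  case (Cons x xs)
  then obtain r1 where r1: "insert_entry r (f x) = Some r1" "table_of f xs r1 = Some r'"
    by (auto split: option.splits)
  then show ?case using Cons.IH[OF r1(2)] insert_entry_Some[OF r1(1) Cons.prems(2)] by auto
qed simp

definition type_entry :: "bool list \<Rightarrow> nat list \<times> nat list list \<times> nat list list" where
  "type_entry xs = (bits_type xs, down_types xs, up_types xs)"

text \<open>The finite computation behind coherence: over all \<open>256\<close> subsets, the type determines the types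
  of the lower and of the upper neighbours, and there are \<open>28\<close> types.\<close>

lemma type_table_check: "map_option length (table_of type_entry all_bits []) = Some 28"
  by code_simp

lemma type_table:
  obtains T where "set T = type_entry ` set all_bits" "distinct (map fst T)" "length T = 28"
proof -
  obtain T where T: "table_of type_entry all_bits [] = Some T" "length T = 28"
    using type_table_check by (auto simp: map_option_eq_Some)
  show thesis using table_of_Some[OF T(1)] T(2) by (intro that[of T]) auto
qed

lemma bits_type_determines_neighbours:
  assumes "xs \<in> set all_bits" "ys \<in> set all_bits" "bits_type xs = bits_type ys"
  shows "down_types xs = down_types ys" "up_types xs = up_types ys"
proof -
  obtain T where T: "set T = type_entry ` set all_bits" "distinct (map fst T)" "length T = 28"
    using type_table .
  have "inj_on fst (type_entry ` set all_bits)" using T(2) unfolding distinct_map T(1) by simp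
  then have "type_entry xs = type_entry ys"
    by (rule inj_onD[OF _ _ imageI[OF assms(1)] imageI[OF assms(2)]])
      (simp add: type_entry_def assms(3))
  then show "down_types xs = down_types ys" "up_types xs = up_types ys" by (simp_all add: type_entry_def)
qed

lemma mset_filter_upt: "mset (filter P [0..<n]) = mset_set {i \<in> {..<n}. P i}"
  by (simp add: mset_filter filter_mset_mset_set lessThan_atLeast0 flip: atLeastLessThan_upt)

lemma mset_down_types:
  assumes "A \<subseteq> {..<8}"
  shows "mset (down_types (bits A)) = image_mset (\<lambda>x. octagon_type (A - {x})) (mset_set A)"
proof -
  have "bits (A - {i}) = (bits A)[i := False]" if "i \<in> A" for i
  proof -
    have "i < 8" using that assms by auto
    then show ?thesis by (intro nth_equalityI) (auto simp: bits_def nth_list_update)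
  qed
  moreover have "{i \<in> {..<8}. bits A ! i} = A" using assms by (auto simp: bits_def)
  moreover have "finite A" using assms finite_subset by blast
  ultimately show ?thesis
    by (simp only: down_types_def mset_sort mset_map mset_filter_upt)
      (auto simp: octagon_type_bits intro!: image_mset_cong)
qed

lemma mset_up_types:
  assumes "A \<subseteq> {..<8}"
  shows "mset (up_types (bits A)) = image_mset (\<lambda>x. octagon_type (insert x A)) (mset_set ({..<8} - A))"
proof -
  have "bits (insert i A) = (bits A)[i := True]" if "i < 8" for i
    using that by (intro nth_equalityI) (auto simp: bits_def nth_list_update)
  moreover have "{i \<in> {..<8}. \<not> bits A ! i} = {..<8} - A" by (auto simp: bits_def)
  ultimately show ?thesis
    by (simp only: up_types_def mset_sort mset_map mset_filter_upt)
      (auto simp: octagon_type_bits intro!: image_mset_cong)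
qed

lemma card_from_type:
  assumes "A \<subseteq> {..<8}"
  shows "card A = hd (octagon_type A)"
proof -
  have "hd (octagon_type A) = length (filter (\<lambda>i. i \<in> A) [0..<8])"
    by (simp add: octagon_type_def octagon_blocks_def comp_def length_filter_map flip: map_concat) 
  also have "\<dots> = card ({i \<in> {..<8}. i \<in> A})"
    by (metis mset_filter_upt size_mset size_mset_set)
  also have "{i \<in> {..<8}. i \<in> A} = A" using assms by auto
  finally show ?thesis by simp
qed

interpretation octagon: equitable_typing 8 octagon_type
proof
  fix A B :: "nat set" assume *: "A \<subseteq> {..<8}" "B \<subseteq> {..<8}" "octagon_type A = octagon_type B"
  show "card A = card B" using * by (simp add: card_from_type)
  note eq = bits_type_determines_neighbours[OF bits_in_all_bits bits_in_all_bits *(3)[unfolded octagon_type_bits]]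
  show "image_mset (\<lambda>x. octagon_type (insert x A)) (mset_set ({..<8} - A)) =
     image_mset (\<lambda>x. octagon_type (insert x B)) (mset_set ({..<8} - B))"
    using eq(2) mset_up_types * by metis
  show "image_mset (\<lambda>x. octagon_type (A - {x})) (mset_set A) = image_mset (\<lambda>x. octagon_type (B - {x})) (mset_set B)"
    using eq(1) mset_down_types * by metis
qed

lemma card_octagon_types: "card (octagon_type ` Pow {..<8}) = 28"
proof -
  have "octagon_type ` Pow {..<8} = set (map bits_type all_bits)"
  proof (intro equalityI subsetI)
    fix t assume "t \<in> set (map bits_type all_bits)"
    then obtain xs where "xs \<in> set all_bits" "t = bits_type xs" by auto
    then show "t \<in> octagon_type ` Pow {..<8}"
      using all_bits_exhaust octagon_type_bits by (metis PowI image_eqI)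
  qed (use bits_in_all_bits octagon_type_bits in auto)
  also have "\<dots> = fst ` type_entry ` set all_bits"
    by (simp add: image_image type_entry_def)
  finally have types: "octagon_type ` Pow {..<8} = fst ` type_entry ` set all_bits" .
  obtain T where T: "set T = type_entry ` set all_bits" "distinct (map fst T)" "length T = 28"
    using type_table .
  have "card (set (map fst T)) = 28" using distinct_card[OF T(2)] T(3) by simp
  then show ?thesis by (simp add: types flip: T(1))
qed

lemma octagon_type_singleton_check: "list_all (\<lambda>i. bits_type (map (\<lambda>k. k = i) [0..<8]) = [1,0,0,0,0,0]) [0..<8]"
  by code_simp

lemma octagon_type_singleton: "i < 8 \<Longrightarrow> octagon_type {i} = [1,0,0,0,0,0]"
  using octagon_type_singleton_check by (simp add: octagon_type_bits bits_def list_all_iff)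

text \<open>Rotations by even angles, composed with the exchange of antipodes among the even vertices.\<close>

definition octagon_syms :: "nat list list" where
  "octagon_syms = [map (\<lambda>x. (x + 2 * a + (if even x then 4 * b else 0)) mod 8) [0..<8]. a \<leftarrow> [0..<4], b \<leftarrow> [0..<2]]"

definition quad_type :: "nat \<Rightarrow> nat \<Rightarrow> nat \<Rightarrow> nat \<Rightarrow> nat list" where
  "quad_type w x y z = bits_type (map (\<lambda>k. k = w \<or> k = x \<or> k = y \<or> k = z) [0..<8])"

text \<open>Stops at the first failure when it is evaluated by rewriting.\<close>

fun lazy_all :: "('a \<Rightarrow> bool) \<Rightarrow> 'a list \<Rightarrow> bool" where
  "lazy_all P [] \<longleftrightarrow> True"
| "lazy_all P (x # xs) \<longleftrightarrow> (if P x then lazy_all P xs else False)"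

lemma lazy_all_iff: "lazy_all P xs \<longleftrightarrow> (\<forall>x\<in>set xs. P x)"
  by (induction xs) auto

fun same_quad :: "nat list \<Rightarrow> nat \<Rightarrow> nat \<times> nat \<times> nat \<Rightarrow> bool" where
  "same_quad p y (i, j, k) \<longleftrightarrow> quad_type (p ! i) (p ! j) (p ! k) y = quad_type i j k (length p)"

text \<open>Whether the partial map \<open>0, ..., length p - 1 \<mapsto> p\<close> can be extended by \<open>length p \<mapsto> y\<close> without
  changing the type of a set of at most four points that contains the new point.\<close>

definition extends :: "nat list \<Rightarrow> nat \<Rightarrow> bool" where
  "extends p y \<longleftrightarrow> (if y \<in> set p then False else
    lazy_all (same_quad p y) [(i, j, k). i \<leftarrow> [0..<length p], j \<leftarrow> [0..<Suc i], k \<leftarrow> [0..<Suc j]])"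

fun extend_by :: "nat list \<Rightarrow> nat list \<Rightarrow> nat list list" where
  "extend_by p [] = []"
| "extend_by p (y # ys) = (if extends p y then (p @ [y]) # extend_by p ys else extend_by p ys)"

fun extensions :: "nat list list \<Rightarrow> nat list list" where
  "extensions [] = []"
| "extensions (p # ps) = extend_by p [0..<8] @ extensions ps"

lemma set_extend_by: "set (extend_by p ys) = {p @ [y] | y. y \<in> set ys \<and> extends p y}"
  by (induction ys) auto

lemma set_extensions: "set (extensions ps) = {p @ [y] | p y. p \<in> set ps \<and> y < 8 \<and> extends p y}"
  by (induction ps) (auto simp: set_extend_by)

text \<open>A search tree whose leaves are the only candidates for elements of the stabiliser.\<close>

lemma extensions_check: "list_all (\<lambda>p. p \<in> set octagon_syms) ((extensions ^^ 8) [[]])"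
  by code_simp

lemma octagon_syms_check:
  "length (remdups octagon_syms) = 8"
  "list_all (\<lambda>p. length p = 8 \<and> distinct p \<and> list_all (\<lambda>i. p ! i < 8 \<and> p ! (p ! (p ! (p ! i))) = i \<and> even (p ! i) = even i) [0..<8]) octagon_syms"
  by code_simp+

text \<open>Conversely all of them preserve the type. Here the set with indicator \<open>xs\<close> is replaced by
  its preimage.\<close>

lemma octagon_syms_preserve:
  "list_all (\<lambda>p. list_all (\<lambda>xs. bits_type (map (\<lambda>i. xs ! (p ! i)) [0..<8]) = bits_type xs) all_bits) octagon_syms"
  by code_simp


lemma octagon_extension:
  assumes \<pi>: "\<pi> permutes {..<8}" "\<forall>A\<subseteq>{..<8}. octagon_type (\<pi> ` A) = octagon_type A" and n: "n < 8"
  shows "extends (map \<pi> [0..<n]) (\<pi> n)"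
proof -
  have quad: "quad_type (\<pi> i) (\<pi> j) (\<pi> k) (\<pi> l) = quad_type i j k l"
    if "i < 8" "j < 8" "k < 8" "l < 8" for i j k l
  proof -
    have qt: "quad_type w x y z = octagon_type {w, x, y, z}" for w x y z
      by (simp add: quad_type_def octagon_type_bits bits_def)
    \<comment> \<open>The four points need not be distinct, so pairs and triples are covered as well.\<close>
    have "octagon_type (\<pi> ` {i, j, k, l}) = octagon_type {i, j, k, l}" 
      using \<pi>(2)[rule_format, of "{i, j, k, l}"] that by simp
    then show ?thesis by (simp add: qt)
  qed
  have "\<pi> n \<notin> \<pi> ` {0..<n}" using permutes_inj[OF \<pi>(1)] by (auto simp: inj_eq)
  then show ?thesis using quad n by (auto simp: extends_def lazy_all_iff)
qed

lemma octagon_stabiliser_in_syms: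
  assumes \<pi>: "\<pi> permutes {..<8}" "\<forall>A\<subseteq>{..<8}. octagon_type (\<pi> ` A) = octagon_type A"
  shows "map \<pi> [0..<8] \<in> set octagon_syms"
proof -
  have "map \<pi> [0..<n] \<in> set ((extensions ^^ n) [[]])" if "n \<le> 8" for n
    using that
  proof (induction n)
    case (Suc n)
    then have "\<pi> n < 8" using permutes_in_image[OF \<pi>(1), of n] by simp
    then show ?case using Suc octagon_extension[OF \<pi>, of n] by (auto simp: set_extensions)
  qed simp
  then show ?thesis using extensions_check by (auto simp: list_all_iff)
qed

definition sym_of :: "nat list \<Rightarrow> nat \<Rightarrow> nat" where
  "sym_of p i = (if i < 8 then p ! i else i)"

lemma octagon_syms_props:
  assumes "p \<in> set octagon_syms"
  shows "length p = 8" "distinct p"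
    and "\<And>i. i < 8 \<Longrightarrow> p ! i < 8 \<and> p ! (p ! (p ! (p ! i))) = i \<and> (even (p ! i) \<longleftrightarrow> even i)"
  using assms octagon_syms_check(2) by (simp_all add: list_all_iff)

lemma sym_of_stabilises:
  assumes p: "p \<in> set octagon_syms"
  shows "sym_of p permutes {..<8}" "A \<subseteq> {..<8} \<Longrightarrow> octagon_type (sym_of p ` A) = octagon_type A"
proof -
  note pp = octagon_syms_props[OF p]
  have inj: "inj_on (sym_of p) {..<8}"
    using pp(1,2) by (auto simp: inj_on_def sym_of_def nth_eq_iff_index_eq)
  have "sym_of p ` {..<8} = {..<8}"
    using pp(3) by (intro endo_inj_surj[OF _ _ inj]) (auto simp: sym_of_def)
  then show perm: "sym_of p permutes {..<8}"
    using inj by (intro bij_imp_permutes) (auto simp: bij_betw_def sym_of_def)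
  assume A: "A \<subseteq> {..<8}"
  have "map (\<lambda>i. bits (sym_of p ` A) ! (p ! i)) [0..<8] = bits A"
  proof -
    have "bits (sym_of p ` A) ! (p ! i) \<longleftrightarrow> i \<in> A" if i: "i < 8" for i
    proof -
      have "bits (sym_of p ` A) ! (p ! i) \<longleftrightarrow> sym_of p i \<in> sym_of p ` A"
        using pp(3)[OF i] i by (simp add: bits_def sym_of_def)
      then show ?thesis using inj_image_mem_iff[OF permutes_inj[OF perm]] by simp
    qed
    then show ?thesis by (simp add: bits_def)
  qed
  moreover have "bits_type (map (\<lambda>i. bits (sym_of p ` A) ! (p ! i)) [0..<8]) = bits_type (bits (sym_of p ` A))"
    using octagon_syms_preserve p bits_in_all_bits unfolding list_all_iff by blast
  ultimately show "octagon_type (sym_of p ` A) = octagon_type A"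
    by (simp add: octagon_type_bits)
qed

definition octagon_stabiliser :: "(nat \<Rightarrow> nat) set" where
  "octagon_stabiliser = {\<pi>. \<pi> permutes {..<8} \<and> (\<forall>A\<subseteq>{..<8}. octagon_type (\<pi> ` A) = octagon_type A)}"

lemma octagon_stabiliser_eq: "octagon_stabiliser = sym_of ` set octagon_syms"
proof (intro equalityI subsetI)
  fix \<pi> assume "\<pi> \<in> octagon_stabiliser"
  then have \<pi>: "\<pi> permutes {..<8}" "\<forall>A\<subseteq>{..<8}. octagon_type (\<pi> ` A) = octagon_type A"
    by (auto simp: octagon_stabiliser_def)
  have "\<pi> = sym_of (map \<pi> [0..<8])"
    using permutes_not_in[OF \<pi>(1)] by (auto simp: fun_eq_iff sym_of_def)
  then show "\<pi> \<in> sym_of ` set octagon_syms"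
    using octagon_stabiliser_in_syms[OF \<pi>] by (rule image_eqI)
qed (auto simp: octagon_stabiliser_def sym_of_stabilises)

lemma card_octagon_stabiliser: "card octagon_stabiliser = 8"
proof -
  have "inj_on sym_of (set octagon_syms)"
  proof (rule inj_onI)
    fix p q assume "p \<in> set octagon_syms" "q \<in> set octagon_syms" and eq: "sym_of p = sym_of q"
    moreover have "p ! i = q ! i" if "i < 8" for i
      using fun_cong[OF eq, of i] that by (simp add: sym_of_def)
    ultimately show "p = q" using octagon_syms_props(1) by (intro nth_equalityI) auto
  qed
  then have "card octagon_stabiliser = card (set octagon_syms)"
    unfolding octagon_stabiliser_eq by (rule card_image)
  also have "\<dots> = 8" using octagon_syms_check(1) by (simp only: length_remdups_card_conv)
  finally show ?thesis .
qed

lemma octagon_stabiliser_exponent: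
  assumes "\<pi> \<in> octagon_stabiliser" shows "\<pi> ^^ 4 = id"
proof
  fix i
  obtain p where p: "p \<in> set octagon_syms" "\<pi> = sym_of p"
    using assms unfolding octagon_stabiliser_eq by blast
  have "\<pi> (\<pi> (\<pi> (\<pi> i))) = i"
    using octagon_syms_props(3)[OF p(1)] by (auto simp: p(2) sym_of_def)
  then show "(\<pi> ^^ 4) i = id i" by (simp add: numeral_eq_Suc)
qed

lemma octagon_stabiliser_even:
  assumes "\<pi> \<in> octagon_stabiliser" shows "\<pi> ` {i \<in> {..<8}. even i} = {i \<in> {..<8}. even i}"
proof -
  obtain p where p: "p \<in> set octagon_syms" "\<pi> = sym_of p"
    using assms unfolding octagon_stabiliser_eq by blast
  have "\<pi> permutes {..<8}" using assms by (simp add: octagon_stabiliser_def)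
  then have "inj_on \<pi> {i \<in> {..<8}. even i}" using permutes_inj inj_on_subset by blast
  then show ?thesis
    using octagon_syms_props(3)[OF p(1)] by (intro endo_inj_surj) (auto simp: p(2) sym_of_def)
qed

section \<open>The scheme of rank 28\<close>

text \<open>Already \<open>3 ^ m \<le> 8 * m!\<close> for \<open>m \<ge> 3\<close>.\<close>

lemma exp_le_order:
  assumes "m \<ge> 3"
  shows "exp (real m) \<le> real (8 * fact m ^ 8)"
proof -
  have "(3::nat) ^ m \<le> 8 * fact m"
    using assms
  proof (induction m rule: dec_induct)
    case base show ?case by (simp add: fact_numeral)
  next
    case (step k)
    have "3 * 3 ^ k \<le> Suc k * (8 * fact k)" using step by (intro mult_mono) auto
    then show ?case by (simp add: algebra_simps)
  qed
  also have "\<dots> \<le> 8 * fact m ^ 8" using self_le_power[of "fact m :: nat" 8] by simp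
  finally have "real (3 ^ m) \<le> real (8 * fact m ^ 8)" by (rule of_nat_mono)
  moreover have "exp (real m) \<le> real (3 ^ m)"
  proof -
    have "exp (real m) = exp 1 ^ m" using exp_of_nat_mult[of m "1::real"] by simp
    also have "\<dots> \<le> 3 ^ m" using exp_le by (intro power_mono) auto
    finally show ?thesis by simp
  qed
  ultimately show ?thesis by linarith
qed

lemma eighth_root_powers:
  assumes "m \<ge> (3::nat)"
  shows "real (m ^ 8) powr (1 / 8) = real m" "real (m ^ 8) powr (7 / 8) = real (m ^ 7)"
proof -
  have m: "real m > 0" using assms by simp
  have e: "real (m ^ 8) = real m powr 8" using powr_realpow[OF m, of 8] by simp
  show "real (m ^ 8) powr (1 / 8) = real m" unfolding e powr_powr using m by simp
  show "real (m ^ 8) powr (7 / 8) = real (m ^ 7)"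
    unfolding e powr_powr using powr_realpow[OF m, of 7] by simp
qed

theorem theorem1p6:
  fixes m n :: nat
  assumes "m \<ge> 3" and "n = m ^ 8"
  shows "\<exists>(V :: nat set) (X :: nat rel set).
           association_scheme V X \<and> primitive_configuration V X \<and>
           card V = n \<and> card X = 28 \<and>
           imprimitive_on V (Aut V X) \<and>
           order (Aut V X) = 8 * fact m ^ 8 \<and>
           real (order (Aut V X)) \<ge> exp (real n powr (1 / 8)) \<and>
           minimal_degree V (Aut V X) = 2 * m ^ 7 \<and>
           real (minimal_degree V (Aut V X)) = 2 * real n powr (7 / 8) \<and>
           thickness (Aut V X) = m \<and>
           real (thickness (Aut V X)) = real n powr (1 / 8)"
proof -
  \<comment> \<open>Any bijection of \<open>{..<m ^ 8}\<close> with the words of length \<open>8\<close> serves as coordinates.\<close>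
  let ?F = "{..<8::nat} \<rightarrow>\<^sub>E {1..m}"
  have "card ?F = card {..<n}" using assms(2) by (simp add: card_PiE)
  then obtain coord :: "nat \<Rightarrow> nat \<Rightarrow> nat" where coord: "bij_betw coord {..<n} ?F"
    using finite_same_card_bij[of "{..<n}" ?F] by (auto simp: finite_PiE)
  interpret hamming_space "{..<n}" coord 8 m
  proof
    show "coord v i \<in> {1..m}" if "v \<in> {..<n}" "i < 8" for v i
      using bij_betwE[OF coord] that by (auto simp: PiE_iff)
    show "u = v" if uv: "u \<in> {..<n}" "v \<in> {..<n}" "\<And>i. i < 8 \<Longrightarrow> coord u i = coord v i" for u v
    proof (rule inj_onD[OF bij_betw_imp_inj_on[OF coord] _ uv(1,2)])
      show "coord u = coord v"
        using bij_betwE[OF coord] uv by (intro PiE_ext[of _ "{..<8}" "\<lambda>_. {1..m}"]) auto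
    qed
    show "\<exists>v\<in>{..<n}. \<forall>i<8. coord v i = f i" if "\<And>i. i < 8 \<Longrightarrow> f i \<in> {1..m}" for f
    proof -
      have "restrict f {..<8} \<in> coord ` {..<n}"
        unfolding bij_betw_imp_surj_on[OF coord] using that by auto
      then obtain v where v: "v \<in> {..<n}" "coord v = restrict f {..<8}" by auto
      show ?thesis by (rule bexI[OF _ v(1)]) (simp add: v(2))
    qed
  qed (rule assms(1))
  interpret hamming_sandwich "{..<n}" coord 8 m octagon_type
    by unfold_locales (simp add: octagon_type_singleton)
  have stab: "stab = octagon_stabiliser"
    by (simp add: stab_def octagon_stabiliser_def)
  have order: "order G = 8 * fact m ^ 8"
    using order_Aut by (simp add: stab card_octagon_stabiliser)
  have degree: "minimal_degree {..<n} G = 2 * m ^ 7"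
    using minimal_degree_Aut by simp
  have thick: "thickness G = m"
    by (rule thickness_Aut) (simp_all add: stab octagon_stabiliser_exponent)
  have "imprimitive_on {..<n} G"
  proof (rule imprimitive_Aut)
    have "1 \<in> {..<8::nat} - {i \<in> {..<8}. even i}" by simp
    then show "{i \<in> {..<8}. even i} \<noteq> {..<8::nat}" by blast
    have "0 \<in> {i \<in> {..<8::nat}. even i}" by simp
    then show "{i \<in> {..<8::nat}. even i} \<noteq> {}" by blast
  qed (auto simp only: stab octagon_stabiliser_even)
  moreover have "card sandwich = 28"
    using card_sandwich card_octagon_types by simp
  ultimately show ?thesis
    using association_scheme_sandwich primitive_sandwich order degree thick
      exp_le_order[OF assms(1)] eighth_root_powers[OF assms(1)] assms(2)
    by (intro exI[of _ "{..<n}"] exI[of _ sandwich]) simp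
qed

end
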